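(* Let $p\ge1$ and $h$ be integers, $f\in\mathcal F_{p,h}$, $K\in\mathcal D_1$, and let $L(\lambda)$ be the Lax matrix. Then the system of ordinary differential equations $$\Phi_{\sigma,x}=\big(\lambda^pf(L(\lambda))\big)_+\Big|_{\lambda=\lambda_\sigma}\Phi_\sigma\qquad(\sigma=1,\dots,r)$$ for real column vectors $\Phi_\sigma=(\phi_{1\sigma},\dots,\phi_{2n,\sigma})^T$ is a Hamiltonian system, i.e. it coincides with $\phi_{j\sigma,x}=\sum_{k=1}^{2n}(W^{-1})_{jk}\,\partial H/\partial\phi_{k\sigma}$, with Hamiltonian function $$H=\frac1{2\kappa m_1\cdots m_N}\,\mathrm{tr}\Big(\mathrm{Res}\,\lambda^pF(L(\lambda))\Big),$$ where $F$ is the matrix-valued polynomial satisfying $F'(\tau)=f(\tau)$ and $F(0)=0$.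
   Context: Algebraic setting. $W$ is a $2n\times 2n$ invertible antisymmetric real matrix. $G=\{A\in GL(2n,\mathbf C): A^TWA=W\}$ and $\mathfrak g=\{X\in gl(2n,\mathbf C): X^T=-WXW^{-1}\}$ is its Lie algebra. $\mathrm{pr}:G\to G/\{\pm I\}$ is the projection. $G_0$ is a finite subgroup of $G$ such that every $A\in G_0$ satisfies $\bar AA=\pm I$ (bar = entrywise complex conjugation); then $\mathrm{pr}(G_0)$ is Abelian. $\Omega_1,\dots,\Omega_N\in G_0$ are such that $\mathrm{pr}(\Omega_1),\dots,\mathrm{pr}(\Omega_N)$ generate $\mathrm{pr}(G_0)$, and $m_a$ is the order of $\mathrm{pr}(\Omega_a)$, so $\Omega_a^{m_a}=\pm I$. $m_0$ is the least common multiple of $m_1,\dots,m_N$. $\Sigma_0=\{\alpha=(\alpha_1,\dots,\alpha_N)\in\mathbf Z^N: 0\le\alpha_a<m_a\}$ and $\Omega^\alpha=\Omega_1^{\alpha_1}\cdots\Omega_N^{\alpha_N}$. $\omega:G_0\to S^1=\{z\in\mathbf C:|z|=1\}$ is a group homomorphism with $\omega(\pm I)=1$; $\omega_a=\omega(\Omega_a)$ and $\omega^\alpha=\omega_1^{\alpha_1}\cdots\omega_N^{\alpha_N}$. For an integer $k$, $\mathcal D_k=\{X\in\mathfrak g: \bar X=X,\ \Omega X\Omega^{-1}=\omega(\Omega)^kX\text{ for all }\Omega\in G_0\}$. For an integer $h$, $\Theta_h$ is the set of matrices $\theta=cg$ with $c\in S^1$, $g\in G_0$, such that $\bar\theta=\theta$,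 $\omega(g)=1$, $\theta^T=W\theta W^{-1}$, and $\Omega\theta\Omega^{-1}=\omega(\Omega)^h\theta$ for all $\Omega\in G_0$. For integers $p,h$, $\mathcal F_{p,h}$ is the set of matrix-valued polynomials $f(\tau)=\sum_{j=1}^s\theta f_{s-j}\tau^{j-1}$ with $s$ a positive integer, $\theta\in\Theta_h$, $f_{s-j}\in\mathbf R$, such that $f_{s-j}\neq0$ only when $j$ is even and $h+j\equiv p+1 \pmod{m_0}$. For a square matrix $X$, $f(X)=\sum_{j=1}^s f_{s-j}\theta X^{j-1}$; likewise $F(\tau)=\sum_{j=1}^s\frac1j\theta f_{s-j}\tau^j$ and $F(X)=\sum_{j=1}^s\frac1jf_{s-j}\theta X^j$. Lax matrix. $\lambda_1,\dots,\lambda_r$ are non-zero real numbers with $\lambda_1^2,\dots,\lambda_r^2$ distinct, $\kappa\ne0$ is a real constant, and $$L(\lambda)=K+\kappa\sum_{\alpha\in\Sigma_0}\sum_{\sigma=1}^r\frac{\Omega^\alpha\Phi_\sigma\Phi_\sigma^T(\Omega^\alpha)^TW}{\lambda-\omega^\alpha\lambda_\sigma}.$$ For a series $N(\lambda)=\sum_{j\le m}N_j\lambda^j$ (expansion at $\lambda=\infty$), $N(\lambda)_+=\sum_{0\le j\le m}N_j\lambda^j$ and $\mathrm{Res}\,N(\lambda)=N_{-1}$, the coefficient of $\lambda^{-1}$. *)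

theory Defs
  imports
    "HOL-Complex_Analysis.Complex_Analysis"
    "HOL-Algebra.Multiplicative_Group"
    "HOL-Algebra.Generated_Groups"
    "HOL-Number_Theory.Cong"
begin

text \<open>
  Multiplication \<open>*\<close> and \<open>^\<close> on the type \<open>complex ^ 'm ^ 'm\<close> are componentwise in the
  library. Below, matrices are always multiplied with \<open>**\<close>, raised to powers with
  \<open>mpow\<close>, and multiplied by complex scalars with \<open>mscale\<close>.
\<close>

abbreviation cmat :: "real ^ 'n ^ 'm \<Rightarrow> complex ^ 'n ^ 'm" where
  "cmat \<equiv> map_matrix complex_of_real"

definition cvec :: "real ^ 'n \<Rightarrow> complex ^ 'n" where
  "cvec v = (\<chi> i. complex_of_real (v $ i))"

abbreviation conj_mat :: "complex ^ 'n ^ 'm \<Rightarrow> complex ^ 'n ^ 'm" where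
  "conj_mat \<equiv> map_matrix cnj"

abbreviation mscale :: "complex \<Rightarrow> complex ^ 'n ^ 'm \<Rightarrow> complex ^ 'n ^ 'm" where
  "mscale c \<equiv> map_matrix ((*) c)"

primrec mpow :: "complex ^ 'm ^ 'm \<Rightarrow> nat \<Rightarrow> complex ^ 'm ^ 'm" where
  "mpow A 0 = mat 1"
| "mpow A (Suc n) = A ** mpow A n"


subsection \<open>The groups\<close>

definition GW :: "real ^ 'm ^ 'm \<Rightarrow> (complex ^ 'm ^ 'm) monoid" where
  "GW W = \<lparr>carrier = {A. invertible A \<and> transpose A ** cmat W ** A = cmat W},
           mult = (**), one = mat 1\<rparr>"

definition pm_one :: "(complex ^ 'm ^ 'm) set" where
  "pm_one = {mat 1, - mat 1}"

abbreviation PGW :: "real ^ 'm ^ 'm \<Rightarrow> (complex ^ 'm ^ 'm) set monoid" where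
  "PGW W \<equiv> GW W Mod pm_one"

definition pr :: "real ^ 'm ^ 'm \<Rightarrow> complex ^ 'm ^ 'm \<Rightarrow> (complex ^ 'm ^ 'm) set" where
  "pr W A = pm_one #>\<^bsub>GW W\<^esub> A"

definition circle_group :: "complex monoid" where
  "circle_group = \<lparr>carrier = {z. cmod z = 1}, mult = (*), one = 1\<rparr>"

definition gW :: "real ^ 'm ^ 'm \<Rightarrow> (complex ^ 'm ^ 'm) set" where
  "gW W = {X. transpose X = - (cmat W ** X ** matrix_inv (cmat W))}"


subsection \<open>The sets $\mathcal D_k$, $\Theta_h$ and $\mathcal F_{p,h}$\<close>

definition D_set ::
  "real ^ 'm ^ 'm \<Rightarrow> (complex ^ 'm ^ 'm) set \<Rightarrow> (complex ^ 'm ^ 'm \<Rightarrow> complex) \<Rightarrow> int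
    \<Rightarrow> (complex ^ 'm ^ 'm) set" where
  "D_set W G\<^sub>0 \<omega> k = {X \<in> gW W. conj_mat X = X \<and>
     (\<forall>A\<in>G\<^sub>0. A ** X ** matrix_inv A = mscale (\<omega> A powi k) X)}"

definition Theta_set ::
  "real ^ 'm ^ 'm \<Rightarrow> (complex ^ 'm ^ 'm) set \<Rightarrow> (complex ^ 'm ^ 'm \<Rightarrow> complex) \<Rightarrow> int
    \<Rightarrow> (complex ^ 'm ^ 'm) set" where
  "Theta_set W G\<^sub>0 \<omega> h = {\<theta>. (\<exists>c g. cmod c = 1 \<and> g \<in> G\<^sub>0 \<and> \<theta> = mscale c g \<and> \<omega> g = 1) \<and>
     conj_mat \<theta> = \<theta> \<and> transpose \<theta> = cmat W ** \<theta> ** matrix_inv (cmat W) \<and>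
     (\<forall>A\<in>G\<^sub>0. A ** \<theta> ** matrix_inv A = mscale (\<omega> A powi h) \<theta>)}"

text \<open>
  A matrix-valued polynomial is a \<open>poly\<close> with matrix coefficients. The function \<open>poly\<close> is not
  used, as it would multiply matrices componentwise; \<open>mpoly_at\<close> is the value at a real
  number and \<open>mpoly_mat\<close> the value at a square matrix, with the coefficients on the left.
\<close>

definition mpoly_at :: "(complex ^ 'm ^ 'm) poly \<Rightarrow> real \<Rightarrow> complex ^ 'm ^ 'm" where
  "mpoly_at f \<tau> = (\<Sum>i\<le>Polynomial.degree f. \<tau> ^ i *\<^sub>R Polynomial.coeff f i)"

definition mpoly_mat :: "(complex ^ 'm ^ 'm) poly \<Rightarrow> complex ^ 'm ^ 'm \<Rightarrow> complex ^ 'm ^ 'm" where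
  "mpoly_mat f X = (\<Sum>i\<le>Polynomial.degree f. Polynomial.coeff f i ** mpow X i)"

definition F_set ::
  "real ^ 'm ^ 'm \<Rightarrow> (complex ^ 'm ^ 'm) set \<Rightarrow> (complex ^ 'm ^ 'm \<Rightarrow> complex) \<Rightarrow> nat
    \<Rightarrow> int \<Rightarrow> int \<Rightarrow> (complex ^ 'm ^ 'm) poly set" where
  "F_set W G\<^sub>0 \<omega> m\<^sub>0 p h =
    {f. \<exists>(s::nat) \<theta> (c :: nat \<Rightarrow> real). s > 0 \<and> \<theta> \<in> Theta_set W G\<^sub>0 \<omega> h \<and>
       (\<forall>j\<in>{1..s}. c (s - j) \<noteq> 0 \<longrightarrow> even j \<and> [h + int j = p + 1] (mod int m\<^sub>0)) \<and>
       f = (\<Sum>j=1..s. Polynomial.monom (c (s - j) *\<^sub>R \<theta>) (j - 1))}"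


subsection \<open>The Lax matrix\<close>

definition Sigma0 :: "nat \<Rightarrow> (nat \<Rightarrow> nat) \<Rightarrow> (nat \<Rightarrow> nat) set" where
  "Sigma0 N m = (\<Pi>\<^sub>E a\<in>{1..N}. {0..<m a})"

text \<open>The ordered product $\Omega_1^{\alpha_1}\cdots\Omega_N^{\alpha_N}$; the factors commute only up to sign.\<close>

definition Omega_pow ::
  "nat \<Rightarrow> (nat \<Rightarrow> complex ^ 'm ^ 'm) \<Rightarrow> (nat \<Rightarrow> nat) \<Rightarrow> complex ^ 'm ^ 'm" where
  "Omega_pow N \<Omega> \<alpha> = foldr (\<lambda>a A. mpow (\<Omega> a) (\<alpha> a) ** A) [1..<Suc N] (mat 1)"

definition omega_pow ::
  "nat \<Rightarrow> (nat \<Rightarrow> complex ^ 'm ^ 'm) \<Rightarrow> (complex ^ 'm ^ 'm \<Rightarrow> complex) \<Rightarrow> (nat \<Rightarrow> nat)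
    \<Rightarrow> complex" where
  "omega_pow N \<Omega> \<omega> \<alpha> = (\<Prod>a=1..N. \<omega> (\<Omega> a) ^ \<alpha> a)"

definition Lax ::
  "real ^ 'm ^ 'm \<Rightarrow> (complex ^ 'm ^ 'm \<Rightarrow> complex) \<Rightarrow> nat \<Rightarrow> (nat \<Rightarrow> complex ^ 'm ^ 'm)
    \<Rightarrow> (nat \<Rightarrow> nat) \<Rightarrow> complex ^ 'm ^ 'm \<Rightarrow> real \<Rightarrow> ('r::finite \<Rightarrow> real)
    \<Rightarrow> real ^ 'm ^ 'r \<Rightarrow> complex \<Rightarrow> complex ^ 'm ^ 'm" where
  "Lax W \<omega> N \<Omega> m K \<kappa> lam \<Phi> l =
     K + mscale (of_real \<kappa>) (\<Sum>\<alpha>\<in>Sigma0 N m. \<Sum>\<sigma>\<in>UNIV.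
       mscale (1 / (l - omega_pow N \<Omega> \<omega> \<alpha> * of_real (lam \<sigma>)))
         (Omega_pow N \<Omega> \<alpha> ** (columnvector (cvec (\<Phi> $ \<sigma>)) :: complex ^ 1 ^ 'm)
           ** rowvector (cvec (\<Phi> $ \<sigma>)) ** transpose (Omega_pow N \<Omega> \<alpha>) ** cmat W))"


subsection \<open>Expansion at infinity\<close>

text \<open>
  With $z = 1/\lambda$, the coefficient of $\lambda^j$ of the expansion at $\lambda=\infty$ is
  the coefficient of $z^{-j}$ of the Laurent expansion at $z=0$.
\<close>

definition inf_coeff :: "(complex \<Rightarrow> complex ^ 'n ^ 'm) \<Rightarrow> int \<Rightarrow> complex ^ 'n ^ 'm" where
  "inf_coeff Q j = (\<chi> a b. fls_nth (laurent_expansion (\<lambda>z. Q (inverse z) $ a $ b) 0) (- j))"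

definition inf_plus :: "(complex \<Rightarrow> complex ^ 'n ^ 'm) \<Rightarrow> complex \<Rightarrow> complex ^ 'n ^ 'm" where
  "inf_plus Q l = (\<Sum>j | 0 \<le> j \<and> inf_coeff Q j \<noteq> 0. mscale (l powi j) (inf_coeff Q j))"

definition Res :: "(complex \<Rightarrow> complex ^ 'n ^ 'm) \<Rightarrow> complex ^ 'n ^ 'm" where
  "Res Q = inf_coeff Q (- 1)"


subsection \<open>The two systems of ordinary differential equations\<close>

text \<open>
  \<open>lax_rhs\<close> and \<open>lax_hamiltonian\<close> are a priori complex-valued. In both, \<open>L\<close> is
  the Lax matrix as a function of the phase-space point and of the spectral parameter.
\<close>

definition lax_rhs ::
  "int \<Rightarrow> (complex ^ 'm ^ 'm) poly \<Rightarrow> ('r::finite \<Rightarrow> real)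
    \<Rightarrow> (real ^ 'm ^ 'r \<Rightarrow> complex \<Rightarrow> complex ^ 'm ^ 'm) \<Rightarrow> real ^ 'm ^ 'r \<Rightarrow> 'r \<Rightarrow> complex ^ 'm" where
  "lax_rhs p f lam L \<Phi> \<sigma> =
     inf_plus (\<lambda>l. mscale (l powi p) (mpoly_mat f (L \<Phi> l))) (of_real (lam \<sigma>)) *v cvec (\<Phi> $ \<sigma>)"

definition lax_hamiltonian ::
  "int \<Rightarrow> (complex ^ 'm ^ 'm) poly \<Rightarrow> real \<Rightarrow> nat \<Rightarrow> (nat \<Rightarrow> nat)
    \<Rightarrow> (real ^ 'm ^ 'r \<Rightarrow> complex \<Rightarrow> complex ^ 'm ^ 'm) \<Rightarrow> real ^ 'm ^ 'r::finite \<Rightarrow> complex" where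
  "lax_hamiltonian p F \<kappa> N m L \<Phi> =
     1 / (2 * of_real \<kappa> * of_nat (\<Prod>a=1..N. m a)) *
       trace (Res (\<lambda>l. mscale (l powi p) (mpoly_mat F (L \<Phi> l))))"

text \<open>The partial derivative $\partial H/\partial\phi_{k\sigma}$; the coordinate $\phi_{k\sigma}$ is \<open>\<Phi> $ \<sigma> $ k\<close>.\<close>

definition phase_partial ::
  "(real ^ 'm ^ 'r::finite \<Rightarrow> real) \<Rightarrow> 'm \<Rightarrow> 'r \<Rightarrow> real ^ 'm ^ 'r \<Rightarrow> real" where
  "phase_partial H k \<sigma> \<Phi> = deriv (\<lambda>t. H (\<Phi> + t *\<^sub>R axis \<sigma> (axis k 1))) 0"

definition hamiltonian_rhs ::
  "real ^ 'm ^ 'm \<Rightarrow> (real ^ 'm ^ 'r::finite \<Rightarrow> real) \<Rightarrow> real ^ 'm ^ 'r \<Rightarrow> 'r \<Rightarrow> real ^ 'm" where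
  "hamiltonian_rhs W H \<Phi> \<sigma> = (\<chi> j. \<Sum>k\<in>UNIV. matrix_inv W $ j $ k * phase_partial H k \<sigma> \<Phi>)"

end

theory Submission
  imports Defs
begin

unbundle no fps_syntax

text \<open>
  Summing over \<open>Sigma0\<close> is, up to a factor, averaging over \<open>G\<^sub>0\<close>, since the summand of
  the Lax matrix depends on $\Omega^\alpha$ only up to sign. In this form $L$, expanded in powers of
  $z = 1/\lambda$, is visibly equivariant: conjugation by $g \in G_0$ multiplies the coefficient of
  $z^k$ by $\omega(g)^{1-k}$, all coefficients are real, and $L^T = -WLW^{-1}$. Every element
  $\theta$ of $\Theta_h$ commutes with $L$, so cyclicity of the trace gives
  $\delta\,\mathrm{tr}\,F(L) = \mathrm{tr}\,f(L)\,\delta L$. In the residue of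
  $\lambda^p\,\mathrm{tr}\,f(L)\,\delta L$ the equivariance makes all poles in a $G_0$-orbit contribute
  equally, and the pole at $\lambda_\sigma$ contributes
  $\mathrm{tr}\,(B_\sigma\,\delta(\Phi_\sigma\Phi_\sigma^T)W)$, where $B_\sigma$ is the value of
  $(\lambda^p f(L))_+$ at $\lambda_\sigma$. As $f$ has only odd powers, $WB_\sigma$ is symmetric, so the
  gradient of $H$ with respect to $\Phi_\sigma$ is $WB_\sigma\Phi_\sigma$.
\<close>

text \<open>Residue and plus part are read off from formal power series in z, where they are finite
  sums of coefficient matrices; once the expansion of L is established, no contours or limits in the
  spectral parameter remain. As L and \<delta>L do not commute, the chain rule holds only under the
  trace. The congruence h + j \<equiv> p + 1 gives every non-zero term of f(L) the same weight p, up
  to multiples of \<open>m\<^sub>0\<close>, which \<omega> does not see; with another weight the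
  summands of an orbit would keep powers of \<omega>(g). The constant in H has three sources:
  varying \<Phi>\<Phi>^T symmetrically gives 2, averaging replaces \<kappa> by \<kappa> m_1...m_N /
  |G_0|, and collapsing the orbits returns the factor |G_0|. The obstacle in the averaging is that
  \<open>Sigma0\<close> is merely a box of exponents, while \<open>G\<^sub>0\<close> is known only
  through generators of its image modulo signs; hence the argument uses translation invariance and
  never counts fibres.\<close>

section \<open>Matrix algebra: signs, sums, inverses and powers\<close>

lemma matrix_mul_uminus_left: "(- A) ** B = - (A ** (B :: 'a::ring_1 ^ 'p ^ 'n))"
  by (simp add: matrix_matrix_mult_def vec_eq_iff sum_negf)

lemma matrix_mul_uminus_right: "A ** (- B) = - (A ** (B :: 'a::ring_1 ^ 'p ^ 'n))"
  by (simp add: matrix_matrix_mult_def vec_eq_iff sum_negf)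

lemma matrix_mul_zero_left: "(0 :: 'a::semiring_1 ^ 'n ^ 'm) ** A = 0"
  by (simp add: vec_eq_iff matrix_matrix_mult_def)

lemma matrix_mul_zero_right: "A ** (0 :: 'a::semiring_1 ^ 'p ^ 'n) = 0"
  by (simp add: vec_eq_iff matrix_matrix_mult_def)

lemma matrix_mul_sum_left: "(\<Sum>i\<in>I. A i) ** B = (\<Sum>i\<in>I. A i ** B)"
  by (simp add: matrix_matrix_mult_def vec_eq_iff sum_distrib_right sum.swap[of _ I])

lemma matrix_mul_sum_right: "A ** (\<Sum>i\<in>I. B i) = (\<Sum>i\<in>I. A ** B i)"
  by (simp add: matrix_matrix_mult_def vec_eq_iff sum_distrib_left sum.swap[of _ I])

lemma conj_mat_mul: "conj_mat (A ** B) = conj_mat A ** conj_mat B"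
  by (simp add: matrix_matrix_mult_def vec_eq_iff)

lemma matrix_inv_cancel:
  fixes A :: "'a::field ^ 'n ^ 'n"
  assumes "invertible A"
  shows "A ** matrix_inv A = mat 1" "matrix_inv A ** A = mat 1"
proof -
  have "A ** matrix_inv A = mat 1 \<and> matrix_inv A ** A = mat 1"
    using assms unfolding invertible_def matrix_inv_def by (rule someI_ex)
  then show "A ** matrix_inv A = mat 1" "matrix_inv A ** A = mat 1"
    by auto
qed

lemma matrix_inv_eqI:
  fixes A :: "'a::field ^ 'n ^ 'n"
  assumes "A ** B = mat 1"
  shows "matrix_inv A = B"
proof -
  have "invertible A"
    using assms invertible_right_inverse by blast
  then have "matrix_inv A ** (A ** B) = B"
    by (simp add: matrix_mul_assoc matrix_inv_cancel)
  then show ?thesis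
    by (simp add: assms)
qed

lemma mpow_Suc_right: "mpow A (Suc k) = mpow A k ** A"
  by (induction k) (simp_all add: matrix_mul_assoc)


subsection \<open>Equality up to sign\<close>

text \<open>Equality in the quotient by the signs, stated on representatives so that computations
  stay with matrices instead of cosets.\<close>

definition pm_eq :: "complex ^ 'm ^ 'm \<Rightarrow> complex ^ 'm ^ 'm \<Rightarrow> bool" where
  "pm_eq A B \<longleftrightarrow> A = B \<or> A = - B"

lemma pm_eq_refl [simp]: "pm_eq A A"
  by (simp add: pm_eq_def)

lemma pm_eq_sym: "pm_eq A B \<Longrightarrow> pm_eq B A"
  by (auto simp: pm_eq_def)

lemma pm_eq_trans [trans]: "pm_eq A B \<Longrightarrow> pm_eq B C \<Longrightarrow> pm_eq A C"
  by (auto simp: pm_eq_def)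

lemma pm_eq_mult: "pm_eq A B \<Longrightarrow> pm_eq C D \<Longrightarrow> pm_eq (A ** C) (B ** D)"
  by (auto simp: pm_eq_def matrix_mul_uminus_left matrix_mul_uminus_right)

text \<open>The coset formula does not ask whether \<open>A\<close> lies in the group, so
  \<open>pr_mult\<close> and \<open>pr_pow\<close> below hold for arbitrary matrices, without
  carrier conditions.\<close>

lemma pr_eq: "pr W A = {A, - A}"
  by (auto simp: pr_def r_coset_def pm_one_def GW_def matrix_mul_uminus_left)

lemma pr_eq_iff: "pr W A = pr W B \<longleftrightarrow> pm_eq A B"
  by (auto simp: pr_eq pm_eq_def doubleton_eq_iff)

lemma pr_mult: "pr W A \<otimes>\<^bsub>PGW W\<^esub> pr W B = pr W (A ** B)"
  by (auto simp: pr_eq set_mult_def GW_def matrix_mul_uminus_left matrix_mul_uminus_right)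

lemma pr_mat_1: "pr W (mat 1) = \<one>\<^bsub>PGW W\<^esub>"
  by (simp add: pr_eq pm_one_def)

lemma pr_pow: "pr W A [^]\<^bsub>PGW W\<^esub> (k::nat) = pr W (mpow A k)"
proof (induction k)
  case 0
  show ?case
    using pr_mat_1[of W] by simp
next
  case (Suc k)
  then show ?case
    unfolding nat_pow_Suc mpow_Suc_right by (simp only: pr_mult)
qed

lemma GW_matrix_inv:
  assumes "A \<in> carrier (GW W)"
  shows "matrix_inv A \<in> carrier (GW W)"
proof -
  have A: "invertible A" "transpose A ** cmat W ** A = cmat W"
    using assms by (auto simp: GW_def)
  have inv: "A ** matrix_inv A = mat 1"
    by (rule matrix_inv_cancel) fact
  have "invertible (matrix_inv A)"
    using A(1) matrix_inv_cancel invertible_def by blast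
  moreover have "transpose (matrix_inv A) ** cmat W ** matrix_inv A
    = transpose (A ** matrix_inv A) ** cmat W ** (A ** matrix_inv A)"
    unfolding matrix_transpose_mul by (metis A(2) matrix_mul_assoc)
  ultimately show ?thesis
    by (simp add: GW_def inv)
qed

lemma group_GW: "group (GW W)"
proof (rule groupI)
  fix A B
  assume "A \<in> carrier (GW W)" "B \<in> carrier (GW W)"
  then show "A \<otimes>\<^bsub>GW W\<^esub> B \<in> carrier (GW W)"
    by (simp add: GW_def invertible_mult matrix_transpose_mul) (metis matrix_mul_assoc)
next
  fix A
  assume "A \<in> carrier (GW W)"
  then show "\<exists>B\<in>carrier (GW W). B \<otimes>\<^bsub>GW W\<^esub> A = \<one>\<^bsub>GW W\<^esub>"
    by (intro bexI[of _ "matrix_inv A"])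
       (auto simp: GW_matrix_inv, simp add: GW_def matrix_inv_cancel)
qed (auto simp: GW_def matrix_mul_assoc invertible_def)

lemma transpose_uminus: "transpose (- A) = - transpose A"
  by (simp add: transpose_def vec_eq_iff)

text \<open>Both signs are central, so left and right cosets agree. This makes \<open>PGW W\<close>
  a group, as the facts about \<open>ord\<close> and about inverses in it require.\<close>

lemma pm_one_normal: "pm_one \<lhd> GW W"
proof -
  interpret group "GW W"
    by (rule group_GW)
  have mem: "mat 1 \<in> carrier (GW W)" "- mat 1 \<in> carrier (GW W)"
    by (auto simp: GW_def invertible_def transpose_uminus matrix_mul_uminus_left
        matrix_mul_uminus_right intro: exI[of _ "- mat 1"])
  have inv: "inv\<^bsub>GW W\<^esub> (- mat 1) = - mat 1"
    using mem by (intro inv_equality) (auto simp: GW_def matrix_mul_uminus_left)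
  have inv1: "inv\<^bsub>GW W\<^esub> (mat 1) = mat 1"
    using inv_one by (simp add: GW_def)
  have "subgroup pm_one (GW W)"
    by (rule subgroupI)
       (use mem inv inv1 in \<open>auto simp: pm_one_def GW_def matrix_mul_uminus_left matrix_mul_uminus_right\<close>)
  then show ?thesis
    by (rule normalI)
       (auto simp: r_coset_def l_coset_def pm_one_def GW_def matrix_mul_uminus_left matrix_mul_uminus_right)
qed

lemma pr_carrier: "A \<in> carrier (GW W) \<Longrightarrow> pr W A \<in> carrier (PGW W)"
  by (auto simp: carrier_FactGroup pr_def)


subsection \<open>The reduction group\<close>

text \<open>The data without generators. The calculus of series below sees only sums over
  \<open>G\<^sub>0\<close>; generators enter in the second locale, to pass from
  \<open>Sigma0\<close> to \<open>G\<^sub>0\<close> and to reduce exponents of \<omega>.\<close>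

locale reduction_group =
  fixes W :: "real ^ 'm ^ 'm"
    and G\<^sub>0 :: "(complex ^ 'm ^ 'm) set"
    and \<omega> :: "complex ^ 'm ^ 'm \<Rightarrow> complex"
  assumes W_invertible: "invertible W" and W_antisym: "transpose W = - W"
    and G0: "subgroup G\<^sub>0 (GW W)" and finite_G0: "finite G\<^sub>0"
    and G0_conj: "\<And>A. A \<in> G\<^sub>0 \<Longrightarrow> conj_mat A ** A = mat 1 \<or> conj_mat A ** A = - mat 1"
    and omega_hom: "\<omega> \<in> hom ((GW W)\<lparr>carrier := G\<^sub>0\<rparr>) circle_group"
    and omega_pm: "\<And>A. A \<in> G\<^sub>0 \<inter> pm_one \<Longrightarrow> \<omega> A = 1"
begin

lemma G0_GW: "A \<in> G\<^sub>0 \<Longrightarrow> A \<in> carrier (GW W)"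
  using G0 subgroup.subset by blast

lemma G0_invertible: "A \<in> G\<^sub>0 \<Longrightarrow> invertible A"
  using G0_GW by (auto simp: GW_def)

lemmas G0_cancel = matrix_inv_cancel[OF G0_invertible]

lemma G0_transpose: "A \<in> G\<^sub>0 \<Longrightarrow> transpose A ** cmat W = cmat W ** matrix_inv A"
  using G0_GW[of A] by (simp add: GW_def) (metis G0_cancel(1) matrix_mul_assoc matrix_mul_rid)

lemma G0_one: "mat 1 \<in> G\<^sub>0"
  using subgroup.one_closed[OF G0] by (simp add: GW_def)

lemma G0_mult: "A \<in> G\<^sub>0 \<Longrightarrow> B \<in> G\<^sub>0 \<Longrightarrow> A ** B \<in> G\<^sub>0"
  using subgroup.m_closed[OF G0, of A B] by (simp add: GW_def)

lemma G0_inv: "A \<in> G\<^sub>0 \<Longrightarrow> matrix_inv A \<in> G\<^sub>0"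
proof -
  assume A: "A \<in> G\<^sub>0"
  interpret group "GW W"
    by (rule group_GW)
  have "inv\<^bsub>GW W\<^esub> A = matrix_inv A"
    using A by (intro inv_equality) (auto simp: G0_GW GW_matrix_inv, simp add: GW_def G0_cancel)
  then show ?thesis
    using subgroup.m_inv_closed[OF G0 A] by simp
qed

lemma G0_mpow: "A \<in> G\<^sub>0 \<Longrightarrow> mpow A k \<in> G\<^sub>0"
  by (induction k) (auto simp: G0_one G0_mult)

lemma bij_betw_G0_mult: "A \<in> G\<^sub>0 \<Longrightarrow> bij_betw ((**) A) G\<^sub>0 G\<^sub>0"
  by (rule bij_betwI[where g = "(**) (matrix_inv A)"])
     (auto simp: G0_mult G0_inv matrix_mul_assoc G0_cancel)

lemma matrix_inv_inv: "A \<in> G\<^sub>0 \<Longrightarrow> matrix_inv (matrix_inv A) = A"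
  by (rule matrix_inv_eqI) (rule G0_cancel)

lemma bij_betw_G0_inv: "bij_betw matrix_inv G\<^sub>0 G\<^sub>0"
  by (rule bij_betwI[where g = matrix_inv]) (auto simp: G0_inv matrix_inv_inv)

lemma omega_mult: "A \<in> G\<^sub>0 \<Longrightarrow> B \<in> G\<^sub>0 \<Longrightarrow> \<omega> (A ** B) = \<omega> A * \<omega> B"
  using hom_mult[OF omega_hom, of A B] by (simp add: GW_def circle_group_def)

lemma cmod_omega: "A \<in> G\<^sub>0 \<Longrightarrow> cmod (\<omega> A) = 1"
  using hom_in_carrier[OF omega_hom, of A] by (simp add: circle_group_def)

lemma omega_nonzero: "A \<in> G\<^sub>0 \<Longrightarrow> \<omega> A \<noteq> 0"
  using cmod_omega by force

lemma omega_one: "\<omega> (mat 1) = 1"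
  by (rule omega_pm) (auto simp: G0_one pm_one_def)

lemma omega_inv: "A \<in> G\<^sub>0 \<Longrightarrow> \<omega> (matrix_inv A) = cnj (\<omega> A)"
proof -
  assume A: "A \<in> G\<^sub>0"
  have "\<omega> A * \<omega> (matrix_inv A) = 1"
    using A by (metis omega_mult G0_inv G0_cancel(1) omega_one)
  moreover have "\<omega> A * cnj (\<omega> A) = 1"
    using cmod_omega[OF A] by (simp add: complex_norm_square[symmetric])
  ultimately show ?thesis
    by (metis omega_nonzero[OF A] mult_left_cancel)
qed

lemma omega_mpow: "A \<in> G\<^sub>0 \<Longrightarrow> \<omega> (mpow A k) = \<omega> A ^ k"
  by (induction k) (auto simp: omega_one omega_mult G0_mpow)

text \<open>The quotient of \<open>A\<close> by \<open>B\<close> is a sign that lies in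
  \<open>G\<^sub>0\<close>, and there \<omega> is 1. Thus \<omega> is a function of the class modulo
  sign.\<close>

lemma omega_pm_eq: "A \<in> G\<^sub>0 \<Longrightarrow> B \<in> G\<^sub>0 \<Longrightarrow> pm_eq A B \<Longrightarrow> \<omega> A = \<omega> B"
proof -
  assume AB: "A \<in> G\<^sub>0" "B \<in> G\<^sub>0" and pm: "pm_eq A B"
  define E where "E = A ** matrix_inv B"
  have "pm_eq E (mat 1)"
    using pm_eq_mult[OF pm, of "matrix_inv B" "matrix_inv B"] AB by (simp add: E_def G0_cancel)
  moreover have "E \<in> G\<^sub>0"
    using AB by (simp add: E_def G0_mult G0_inv)
  ultimately have "\<omega> E = 1"
    by (intro omega_pm) (auto simp: pm_one_def pm_eq_def)
  moreover have "A = E ** B"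
    unfolding E_def by (simp add: AB G0_cancel flip: matrix_mul_assoc)
  ultimately show ?thesis
    using \<open>E \<in> G\<^sub>0\<close> AB omega_mult by simp
qed

text \<open>Entrywise conjugation acts on \<open>G\<^sub>0\<close> as inversion up to sign. Both the
  commutativity modulo signs and the reality of the Lax coefficients come from this.\<close>

lemma conj_G0: "A \<in> G\<^sub>0 \<Longrightarrow> pm_eq (conj_mat A) (matrix_inv A)"
  using G0_conj[of A]
  by (auto simp: pm_eq_def)
     (metis G0_cancel(1) matrix_mul_assoc matrix_mul_rid matrix_mul_lid matrix_mul_uminus_left)+

lemma matrix_inv_mult: "A \<in> G\<^sub>0 \<Longrightarrow> B \<in> G\<^sub>0 \<Longrightarrow> matrix_inv (A ** B) = matrix_inv B ** matrix_inv A"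
  by (rule matrix_inv_eqI) (metis G0_cancel(1) matrix_mul_assoc matrix_mul_rid)

text \<open>Conjugation preserves the order of a product and inversion reverses it. As they agree up
  to sign, inverses commute up to sign; multiplying by \<open>A ** B\<close> on the left and
  \<open>B ** A\<close> on the right transfers this to the elements.\<close>

lemma G0_commute:
  assumes A: "A \<in> G\<^sub>0" and B: "B \<in> G\<^sub>0"
  shows "pm_eq (A ** B) (B ** A)"
proof -
  have "pm_eq (matrix_inv A ** matrix_inv B) (conj_mat A ** conj_mat B)"
    using A B by (intro pm_eq_mult pm_eq_sym[OF conj_G0])
  also have "conj_mat A ** conj_mat B = conj_mat (A ** B)"
    by (simp add: conj_mat_mul)
  also have "pm_eq \<dots> (matrix_inv B ** matrix_inv A)"
    using A B conj_G0[of "A ** B"] by (simp add: G0_mult matrix_inv_mult)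
  finally have "pm_eq ((A ** B) ** (matrix_inv A ** matrix_inv B) ** (B ** A))
      ((A ** B) ** (matrix_inv B ** matrix_inv A) ** (B ** A))"
    by (intro pm_eq_mult[OF pm_eq_mult] pm_eq_refl)
  moreover have "(A ** B) ** (matrix_inv A ** matrix_inv B) ** (B ** A) = A ** B"
    by (metis A B G0_cancel(2) matrix_mul_assoc matrix_mul_lid matrix_mul_rid)
  moreover have "(A ** B) ** (matrix_inv B ** matrix_inv A) ** (B ** A) = B ** A"
    by (metis A B G0_cancel(1) matrix_mul_assoc matrix_mul_lid matrix_mul_rid)
  ultimately show ?thesis
    by simp
qed

end

section \<open>Generators, multi-indices and averaging\<close>

locale reduction_generators = reduction_group W G\<^sub>0 \<omega>
  for W :: "real ^ 'm ^ 'm" and G\<^sub>0 and \<omega> +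
  fixes N :: nat and \<Omega> :: "nat \<Rightarrow> complex ^ 'm ^ 'm" and m :: "nat \<Rightarrow> nat"
  assumes Omega_in: "\<And>a. a \<in> {1..N} \<Longrightarrow> \<Omega> a \<in> G\<^sub>0"
    and Omega_gen: "generate (PGW W) ((\<lambda>a. pr W (\<Omega> a)) ` {1..N}) = pr W ` G\<^sub>0"
    and m: "\<And>a. a \<in> {1..N} \<Longrightarrow> m a = group.ord (PGW W) (pr W (\<Omega> a))"
begin

lemma mpow_Omega_m: "a \<in> {1..N} \<Longrightarrow> pm_eq (mpow (\<Omega> a) (m a)) (mat 1)"
  and m_pos: "a \<in> {1..N} \<Longrightarrow> m a > 0"
proof -
  assume a: "a \<in> {1..N}"
  interpret P: group "PGW W"
    by (rule normal.factorgroup_is_group[OF pm_one_normal])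
  have pr: "pr W (\<Omega> a) \<in> carrier (PGW W)"
    using a by (intro pr_carrier G0_GW Omega_in)
  have "pr W (mpow (\<Omega> a) (m a)) = pr W (mat 1)"
    unfolding pr_pow[symmetric] m[OF a] pr_mat_1 using pr by (rule P.pow_ord_eq_1)
  then show "pm_eq (mpow (\<Omega> a) (m a)) (mat 1)"
    by (simp add: pr_eq_iff)
  \<comment> \<open>\<open>ord\<close> is 0 for an element of infinite order, so positivity of
    \<open>m a\<close> needs an exponent that kills the class; the order of the finite group
    \<open>G\<^sub>0\<close> is one.\<close>
  define S where "S = GW W \<lparr>carrier := G\<^sub>0\<rparr>"
  interpret S: group S
    unfolding S_def by (rule subgroup.subgroup_is_group[OF G0 group_GW])
  have pow: "A [^]\<^bsub>S\<^esub> (k::nat) = mpow A k" for A k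
    by (induction k) (simp_all add: S_def GW_def mpow_Suc_right del: mpow.simps(2))
  have "mpow (\<Omega> a) (Coset.order S) = mat 1"
    using S.pow_order_eq_1[of "\<Omega> a"] Omega_in[OF a] by (simp only: pow) (simp add: S_def GW_def)
  moreover have "Coset.order S > 0"
    using finite_G0 by (simp add: S.order_gt_0_iff_finite) (simp add: S_def)
  ultimately have "\<exists>k::nat. k \<noteq> 0 \<and> pr W (\<Omega> a) [^]\<^bsub>PGW W\<^esub> k = \<one>\<^bsub>PGW W\<^esub>"
    by (intro exI[of _ "Coset.order S"]) (simp add: pr_pow pr_mat_1 del: one_FactGroup)
  then show "m a > 0"
    unfolding m[OF a] using P.ord_eq_0[OF pr] by blast
qed

lemma omega_Omega_m: "a \<in> {1..N} \<Longrightarrow> \<omega> (\<Omega> a) ^ m a = 1"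
  using omega_pm_eq[OF _ _ mpow_Omega_m] by (simp add: G0_mpow Omega_in G0_one omega_one omega_mpow)

text \<open>The list of indices is left arbitrary so that the factors can be removed one by one in
  inductions.\<close>

abbreviation "ordered_prod xs \<alpha> \<equiv> foldr (\<lambda>a A. mpow (\<Omega> a) (\<alpha> a) ** A) xs (mat 1)"

lemma ordered_prod_in: "set xs \<subseteq> {1..N} \<Longrightarrow> ordered_prod xs \<alpha> \<in> G\<^sub>0"
  by (induction xs) (auto simp: G0_one G0_mult G0_mpow Omega_in)

lemma omega_ordered_prod:
  "set xs \<subseteq> {1..N} \<Longrightarrow> \<omega> (ordered_prod xs \<alpha>) = (\<Prod>a\<leftarrow>xs. \<omega> (\<Omega> a) ^ \<alpha> a)"
  by (induction xs) (auto simp: omega_one omega_mult omega_mpow G0_mpow ordered_prod_in Omega_in)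

lemma ordered_prod_cong:
  assumes "\<And>x. x \<in> set xs \<Longrightarrow> pm_eq (mpow (\<Omega> x) (\<alpha> x)) (mpow (\<Omega> x) (\<beta> x))"
  shows "pm_eq (ordered_prod xs \<alpha>) (ordered_prod xs \<beta>)"
  using assms by (induction xs) (auto intro!: pm_eq_mult)

text \<open>The extra factor moves to the right, each exchange costing a sign, until it meets its
  own power; distinctness of the list ensures that only one exponent changes.\<close>

lemma Omega_ordered_prod:
  assumes "distinct xs" "set xs \<subseteq> {1..N}" "a \<in> set xs"
  shows "pm_eq (\<Omega> a ** ordered_prod xs \<alpha>) (ordered_prod xs (\<alpha>(a := Suc (\<alpha> a))))"
  using assms
proof (induction xs)
  case (Cons x xs)
  show ?case
  proof (cases "x = a")
    case True
    have "pm_eq (ordered_prod xs \<alpha>) (ordered_prod xs (\<alpha>(a := Suc (\<alpha> a))))"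
      using True Cons.prems by (intro ordered_prod_cong) auto
    then show ?thesis
      using True by (auto simp: matrix_mul_assoc intro: pm_eq_mult)
  next
    case False
    have "pm_eq ((\<Omega> a ** mpow (\<Omega> x) (\<alpha> x)) ** ordered_prod xs \<alpha>)
      ((mpow (\<Omega> x) (\<alpha> x) ** \<Omega> a) ** ordered_prod xs \<alpha>)"
      using Cons.prems by (intro pm_eq_mult G0_commute G0_mpow Omega_in) auto
    also have "(mpow (\<Omega> x) (\<alpha> x) ** \<Omega> a) ** ordered_prod xs \<alpha>
      = mpow (\<Omega> x) (\<alpha> x) ** (\<Omega> a ** ordered_prod xs \<alpha>)"
      by (simp add: matrix_mul_assoc)
    also have "pm_eq \<dots> (mpow (\<Omega> x) (\<alpha> x) ** ordered_prod xs (\<alpha>(a := Suc (\<alpha> a))))"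
      using Cons False by (intro pm_eq_mult) auto
    finally show ?thesis
      using False by (simp add: matrix_mul_assoc)
  qed
qed auto

lemma Omega_pow_in: "Omega_pow N \<Omega> \<alpha> \<in> G\<^sub>0"
  unfolding Omega_pow_def by (rule ordered_prod_in) auto

lemma omega_pow_eq: "omega_pow N \<Omega> \<omega> \<alpha> = \<omega> (Omega_pow N \<Omega> \<alpha>)"
proof -
  have "\<omega> (Omega_pow N \<Omega> \<alpha>) = (\<Prod>a\<leftarrow>[1..<Suc N]. \<omega> (\<Omega> a) ^ \<alpha> a)"
    unfolding Omega_pow_def by (rule omega_ordered_prod) auto
  also have "\<dots> = (\<Prod>a\<in>set [1..<Suc N]. \<omega> (\<Omega> a) ^ \<alpha> a)"
    by (subst prod.distinct_set_conv_list) auto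
  finally show ?thesis
    by (simp add: omega_pow_def atLeastLessThanSuc_atLeastAtMost del: upt_Suc)
qed

text \<open>The cyclic shift of one exponent, which stays in the box \<open>Sigma0\<close>; the
  wrap-around is harmless modulo signs because \<open>\<Omega> a\<close> to the power
  \<open>m a\<close> is a sign.\<close>

definition increment :: "nat \<Rightarrow> (nat \<Rightarrow> nat) \<Rightarrow> nat \<Rightarrow> nat" where
  "increment a \<alpha> = \<alpha>(a := Suc (\<alpha> a) mod m a)"

lemma Omega_Omega_pow:
  assumes a: "a \<in> {1..N}" and \<alpha>: "\<alpha> \<in> Sigma0 N m"
  shows "pm_eq (\<Omega> a ** Omega_pow N \<Omega> \<alpha>) (Omega_pow N \<Omega> (increment a \<alpha>))"
proof -
  have "pm_eq (\<Omega> a ** Omega_pow N \<Omega> \<alpha>) (Omega_pow N \<Omega> (\<alpha>(a := Suc (\<alpha> a))))"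
    unfolding Omega_pow_def using a by (intro Omega_ordered_prod) auto
  also have "pm_eq \<dots> (Omega_pow N \<Omega> (increment a \<alpha>))"
    unfolding Omega_pow_def
  proof (rule ordered_prod_cong)
    fix x
    have "\<alpha> a < m a"
      using \<alpha> a by (auto simp: Sigma0_def PiE_def Pi_def)
    \<comment> \<open>The only case with content is x = a with exponent m a - 1: the incremented
      power is a sign, the wrapped one is the identity.\<close>
    then show "pm_eq (mpow (\<Omega> x) ((\<alpha>(a := Suc (\<alpha> a))) x)) (mpow (\<Omega> x) (increment a \<alpha> x))"
      using mpow_Omega_m[OF a] by (auto simp: increment_def mod_Suc simp del: mpow.simps(2))
  qed
  finally show ?thesis .
qed

lemma finite_Sigma0: "finite (Sigma0 N m)"
  by (auto simp: Sigma0_def intro: finite_PiE)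

lemma card_Sigma0: "card (Sigma0 N m) = (\<Prod>a=1..N. m a)"
  by (simp add: Sigma0_def card_PiE)

lemma bij_betw_increment:
  assumes a: "a \<in> {1..N}"
  shows "bij_betw (increment a) (Sigma0 N m) (Sigma0 N m)"
proof -
  have "inj_on (increment a) (Sigma0 N m)"
  proof (rule inj_onI, rule ext)
    fix \<alpha> \<beta> x
    assume *: "\<alpha> \<in> Sigma0 N m" "\<beta> \<in> Sigma0 N m" "increment a \<alpha> = increment a \<beta>"
    have "\<alpha> a < m a" "\<beta> a < m a"
      using * a by (auto simp: Sigma0_def PiE_def Pi_def)
    moreover have "Suc (\<alpha> a) mod m a = Suc (\<beta> a) mod m a"
      using fun_cong[OF *(3), of a] by (simp add: increment_def)
    ultimately have "\<alpha> a = \<beta> a"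
      by (auto simp: mod_Suc split: if_splits)
    then show "\<alpha> x = \<beta> x"
      using fun_cong[OF *(3), of x] by (auto simp: increment_def split: if_splits)
  qed
  moreover have "increment a ` Sigma0 N m \<subseteq> Sigma0 N m"
    using a m_pos[OF a] by (fastforce simp: Sigma0_def increment_def PiE_def Pi_def extensional_def)
  ultimately show ?thesis
    using finite_Sigma0 by (simp add: bij_betw_def endo_inj_surj)
qed

text \<open>Translation by a generator permutes the summands through \<open>increment\<close>. The
  admissible translations are closed under products, inverses and change of sign, so they exhaust
  \<open>G\<^sub>0\<close>.\<close>

lemma sum_Sigma0_shift:
  fixes \<Psi> :: "complex ^ 'm ^ 'm \<Rightarrow> 'b::comm_monoid_add"
  assumes even: "\<And>A B. A \<in> G\<^sub>0 \<Longrightarrow> B \<in> G\<^sub>0 \<Longrightarrow> pm_eq A B \<Longrightarrow> \<Psi> A = \<Psi> B"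
    and g: "g \<in> G\<^sub>0"
  shows "(\<Sum>\<alpha>\<in>Sigma0 N m. \<Psi> (g ** Omega_pow N \<Omega> \<alpha>)) = (\<Sum>\<alpha>\<in>Sigma0 N m. \<Psi> (Omega_pow N \<Omega> \<alpha>))"
proof -
  define E where "E = {\<Psi> :: complex ^ 'm ^ 'm \<Rightarrow> 'b. \<forall>A\<in>G\<^sub>0. \<forall>B\<in>G\<^sub>0. pm_eq A B \<longrightarrow> \<Psi> A = \<Psi> B}"
  \<comment> \<open>\<open>T\<close> quantifies over all functions in \<open>E\<close>, because the
    closure under products and inverses applies it to a translated function in place of
    \<Psi>.\<close>
  define T where "T g \<longleftrightarrow> (\<forall>\<Psi>\<in>E. (\<Sum>\<alpha>\<in>Sigma0 N m. \<Psi> (g ** Omega_pow N \<Omega> \<alpha>))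
    = (\<Sum>\<alpha>\<in>Sigma0 N m. \<Psi> (Omega_pow N \<Omega> \<alpha>)))" for g
  interpret P: group "PGW W"
    by (rule normal.factorgroup_is_group[OF pm_one_normal])
  have translate: "(\<lambda>A. \<Psi> (g ** A)) \<in> E" if "\<Psi> \<in> E" "g \<in> G\<^sub>0" for \<Psi> g
    using that by (auto simp: E_def G0_mult pm_eq_mult)
  have T_pm: "T g" if "T h" "h \<in> G\<^sub>0" "g \<in> G\<^sub>0" "pm_eq g h" for g h
    unfolding T_def
  proof
    fix \<Psi>
    assume \<Psi>: "\<Psi> \<in> E"
    have "\<Psi> (g ** Omega_pow N \<Omega> \<alpha>) = \<Psi> (h ** Omega_pow N \<Omega> \<alpha>)" for \<alpha>
      using that \<Psi> by (auto simp: E_def G0_mult Omega_pow_in pm_eq_mult)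
    then show "(\<Sum>\<alpha>\<in>Sigma0 N m. \<Psi> (g ** Omega_pow N \<Omega> \<alpha>))
      = (\<Sum>\<alpha>\<in>Sigma0 N m. \<Psi> (Omega_pow N \<Omega> \<alpha>))"
      using \<open>T h\<close> \<Psi> by (simp add: T_def)
  qed
  have T_one: "T (mat 1)"
    by (simp add: T_def)
  have T_mult: "T (g ** h)" if "T g" "T h" "g \<in> G\<^sub>0" for g h
    unfolding T_def
  proof
    fix \<Psi>
    assume \<Psi>: "\<Psi> \<in> E"
    have "(\<Sum>\<alpha>\<in>Sigma0 N m. \<Psi> (g ** h ** Omega_pow N \<Omega> \<alpha>))
      = (\<Sum>\<alpha>\<in>Sigma0 N m. \<Psi> (g ** Omega_pow N \<Omega> \<alpha>))"
      using bspec[OF \<open>T h\<close>[unfolded T_def] translate[OF \<Psi> \<open>g \<in> G\<^sub>0\<close>]]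
      by (simp flip: matrix_mul_assoc)
    also have "\<dots> = (\<Sum>\<alpha>\<in>Sigma0 N m. \<Psi> (Omega_pow N \<Omega> \<alpha>))"
      using \<open>T g\<close> \<Psi> by (simp add: T_def)
    finally show "(\<Sum>\<alpha>\<in>Sigma0 N m. \<Psi> (g ** h ** Omega_pow N \<Omega> \<alpha>))
      = (\<Sum>\<alpha>\<in>Sigma0 N m. \<Psi> (Omega_pow N \<Omega> \<alpha>))" .
  qed
  have T_inv: "T (matrix_inv g)" if "T g" "g \<in> G\<^sub>0" for g
    unfolding T_def
  proof
    fix \<Psi>
    assume "\<Psi> \<in> E"
    then have "(\<Sum>\<alpha>\<in>Sigma0 N m. \<Psi> (matrix_inv g ** (g ** Omega_pow N \<Omega> \<alpha>)))
      = (\<Sum>\<alpha>\<in>Sigma0 N m. \<Psi> (matrix_inv g ** Omega_pow N \<Omega> \<alpha>))"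
      using bspec[OF \<open>T g\<close>[unfolded T_def] translate[OF _ G0_inv[OF \<open>g \<in> G\<^sub>0\<close>]]]
      by simp
    then show "(\<Sum>\<alpha>\<in>Sigma0 N m. \<Psi> (matrix_inv g ** Omega_pow N \<Omega> \<alpha>))
      = (\<Sum>\<alpha>\<in>Sigma0 N m. \<Psi> (Omega_pow N \<Omega> \<alpha>))"
      using that by (simp add: matrix_mul_assoc G0_cancel)
  qed
  have T_Omega: "T (\<Omega> a)" if a: "a \<in> {1..N}" for a
    unfolding T_def
  proof
    fix \<Psi>
    assume \<Psi>: "\<Psi> \<in> E"
    have "(\<Sum>\<alpha>\<in>Sigma0 N m. \<Psi> (\<Omega> a ** Omega_pow N \<Omega> \<alpha>))
      = (\<Sum>\<alpha>\<in>Sigma0 N m. \<Psi> (Omega_pow N \<Omega> (increment a \<alpha>)))"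
    proof (rule sum.cong)
      fix \<alpha>
      assume "\<alpha> \<in> Sigma0 N m"
      from Omega_Omega_pow[OF a this] show "\<Psi> (\<Omega> a ** Omega_pow N \<Omega> \<alpha>) = \<Psi> (Omega_pow N \<Omega> (increment a \<alpha>))"
        using \<Psi> G0_mult[OF Omega_in[OF a] Omega_pow_in] Omega_pow_in by (simp add: E_def)
    qed simp
    also have "\<dots> = (\<Sum>\<alpha>\<in>Sigma0 N m. \<Psi> (Omega_pow N \<Omega> \<alpha>))"
      by (rule sum.reindex_bij_betw[OF bij_betw_increment[OF a]])
    finally show "(\<Sum>\<alpha>\<in>Sigma0 N m. \<Psi> (\<Omega> a ** Omega_pow N \<Omega> \<alpha>))
      = (\<Sum>\<alpha>\<in>Sigma0 N m. \<Psi> (Omega_pow N \<Omega> \<alpha>))" .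
  qed
  \<comment> \<open>Generation takes place in the quotient, so the induction yields only some
    representative of each class; \<open>T_pm\<close> then moves from it to the given
    element.\<close>
  have "\<exists>g\<in>G\<^sub>0. X = pr W g \<and> T g" if "X \<in> generate (PGW W) ((\<lambda>a. pr W (\<Omega> a)) ` {1..N})" for X
    using that
  proof induction
    case one
    show ?case
      using pr_mat_1 T_one G0_one by metis
  next
    case (incl X)
    then show ?case
      using T_Omega Omega_in by auto
  next
    case (inv X)
    then obtain a where a: "a \<in> {1..N}" "X = pr W (\<Omega> a)"
      by auto
    have "inv\<^bsub>PGW W\<^esub> X = pr W (matrix_inv (\<Omega> a))"
    proof (rule P.inv_equality)
      show "pr W (matrix_inv (\<Omega> a)) \<otimes>\<^bsub>PGW W\<^esub> X = \<one>\<^bsub>PGW W\<^esub>"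
        by (simp only: a(2) pr_mult G0_cancel[OF Omega_in[OF a(1)]] pr_mat_1)
    qed (use a in \<open>auto simp only: intro!: pr_carrier G0_GW G0_inv Omega_in\<close>)
    moreover have "T (matrix_inv (\<Omega> a))" "matrix_inv (\<Omega> a) \<in> G\<^sub>0"
      using a(1) by (auto intro!: T_inv T_Omega G0_inv Omega_in simp del: atLeastAtMost_iff)
    ultimately show ?case
      by blast
  next
    case (eng X Y)
    then obtain g h where "g \<in> G\<^sub>0" "X = pr W g" "T g" "h \<in> G\<^sub>0" "Y = pr W h" "T h"
      by auto
    then have "X \<otimes>\<^bsub>PGW W\<^esub> Y = pr W (g ** h)" "T (g ** h)" "g ** h \<in> G\<^sub>0"
      by (simp_all only: pr_mult T_mult G0_mult)
    then show ?case
      by blast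
  qed
  then obtain h where h: "h \<in> G\<^sub>0" "pr W g = pr W h" "T h"
    using g Omega_gen by blast
  have "T g"
    by (rule T_pm[OF h(3,1) g]) (use h(2) in \<open>simp only: pr_eq_iff\<close>)
  moreover have "\<Psi> \<in> E"
    unfolding E_def using even by blast
  ultimately show ?thesis
    unfolding T_def by blast
qed

text \<open>The generators need not be independent in \<open>PGW W\<close>, so \<open>Sigma0\<close> may cover
  the quotient of \<open>G\<^sub>0\<close> several times; invariance under translation makes the cover uniform.\<close>

lemma sum_Sigma0_eq_average:
  fixes \<Psi> :: "complex ^ 'm ^ 'm \<Rightarrow> 'b::real_vector"
  assumes even: "\<And>A B. A \<in> G\<^sub>0 \<Longrightarrow> B \<in> G\<^sub>0 \<Longrightarrow> pm_eq A B \<Longrightarrow> \<Psi> A = \<Psi> B"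
  shows "(\<Sum>\<alpha>\<in>Sigma0 N m. \<Psi> (Omega_pow N \<Omega> \<alpha>))
    = (real (\<Prod>a=1..N. m a) / real (card G\<^sub>0)) *\<^sub>R (\<Sum>g\<in>G\<^sub>0. \<Psi> g)"
proof -
  let ?S = "\<Sum>\<alpha>\<in>Sigma0 N m. \<Psi> (Omega_pow N \<Omega> \<alpha>)"
  \<comment> \<open>Right translation is turned into left translation at the cost of a sign, to
    which \<Psi> is blind.\<close>
  have translate: "(\<Sum>g\<in>G\<^sub>0. \<Psi> (g ** A)) = (\<Sum>g\<in>G\<^sub>0. \<Psi> g)" if A: "A \<in> G\<^sub>0" for A
  proof -
    have "(\<Sum>g\<in>G\<^sub>0. \<Psi> (g ** A)) = (\<Sum>g\<in>G\<^sub>0. \<Psi> (A ** g))"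
      using A by (intro sum.cong refl even G0_mult G0_commute)
    also have "\<dots> = (\<Sum>g\<in>G\<^sub>0. \<Psi> g)"
      by (rule sum.reindex_bij_betw[OF bij_betw_G0_mult[OF A]])
    finally show ?thesis .
  qed
  \<comment> \<open>Double counting of the sum of \<Psi>(g \<Omega>^\<alpha>): for fixed g the sum
    over \<alpha> does not depend on g, and for fixed \<alpha> the sum over g does not depend on
    \<alpha>.\<close>
  have "real (card G\<^sub>0) *\<^sub>R ?S = (\<Sum>g\<in>G\<^sub>0. ?S)"
    by (simp add: sum_constant_scaleR)
  also have "\<dots> = (\<Sum>g\<in>G\<^sub>0. \<Sum>\<alpha>\<in>Sigma0 N m. \<Psi> (g ** Omega_pow N \<Omega> \<alpha>))"
    using even by (intro sum.cong refl sum_Sigma0_shift[symmetric])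
  also have "\<dots> = (\<Sum>\<alpha>\<in>Sigma0 N m. \<Sum>g\<in>G\<^sub>0. \<Psi> (g ** Omega_pow N \<Omega> \<alpha>))"
    by (rule sum.swap)
  also have "\<dots> = (\<Sum>\<alpha>\<in>Sigma0 N m. \<Sum>g\<in>G\<^sub>0. \<Psi> g)"
    by (intro sum.cong refl translate Omega_pow_in)
  also have "\<dots> = real (\<Prod>a=1..N. m a) *\<^sub>R (\<Sum>g\<in>G\<^sub>0. \<Psi> g)"
    by (simp add: sum_constant_scaleR card_Sigma0)
  finally have "real (card G\<^sub>0) *\<^sub>R ?S = real (\<Prod>a=1..N. m a) *\<^sub>R (\<Sum>g\<in>G\<^sub>0. \<Psi> g)" .
  then have "(1 / real (card G\<^sub>0)) *\<^sub>R (real (card G\<^sub>0) *\<^sub>R ?S)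
    = (1 / real (card G\<^sub>0)) *\<^sub>R (real (\<Prod>a=1..N. m a) *\<^sub>R (\<Sum>g\<in>G\<^sub>0. \<Psi> g))"
    by simp
  moreover have "card G\<^sub>0 > 0"
    using finite_G0 G0_one card_gt_0_iff by blast
  ultimately show ?thesis
    by simp
qed

text \<open>Apply the averaging formula to the indicator of the class of \<open>g\<close>: its sum
  over \<open>G\<^sub>0\<close> is positive, so its sum over \<open>Sigma0\<close> cannot
  vanish.\<close>

lemma ex_Omega_pow:
  assumes g: "g \<in> G\<^sub>0"
  shows "\<exists>\<alpha>. pm_eq (Omega_pow N \<Omega> \<alpha>) g"
proof (rule ccontr)
  assume none: "\<nexists>\<alpha>. pm_eq (Omega_pow N \<Omega> \<alpha>) g"
  define \<Psi> :: "complex ^ 'm ^ 'm \<Rightarrow> real" where "\<Psi> A = of_bool (pm_eq A g)" for A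
  have "(\<Sum>\<alpha>\<in>Sigma0 N m. \<Psi> (Omega_pow N \<Omega> \<alpha>))
    = (real (\<Prod>a=1..N. m a) / real (card G\<^sub>0)) *\<^sub>R (\<Sum>g\<in>G\<^sub>0. \<Psi> g)"
  proof (rule sum_Sigma0_eq_average)
    fix A B :: "complex ^ 'm ^ 'm"
    assume "pm_eq A B"
    then have "pm_eq A g \<longleftrightarrow> pm_eq B g"
      by (meson pm_eq_trans pm_eq_sym)
    then show "\<Psi> A = \<Psi> B"
      by (simp add: \<Psi>_def)
  qed
  moreover have "(\<Sum>\<alpha>\<in>Sigma0 N m. \<Psi> (Omega_pow N \<Omega> \<alpha>)) = 0"
    using none by (simp add: \<Psi>_def)
  moreover have "(\<Sum>g\<in>G\<^sub>0. \<Psi> g) > 0"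
    using g by (intro sum_pos2[OF finite_G0 g]) (auto simp: \<Psi>_def)
  moreover have "real (\<Prod>a=1..N. m a) \<noteq> 0" "card G\<^sub>0 > 0"
    using m_pos finite_G0 g by (force simp: card_gt_0_iff)+
  ultimately show False
    by (simp del: of_nat_prod)
qed

text \<open>Up to sign every element is a product of generator powers, and \<omega> of each
  generator is a root of unity of order dividing its \<open>m a\<close>.\<close>

lemma omega_pow_Lcm:
  assumes g: "g \<in> G\<^sub>0"
  shows "\<omega> g ^ Lcm (m ` {1..N}) = 1"
proof -
  obtain \<alpha> where "pm_eq (Omega_pow N \<Omega> \<alpha>) g"
    using ex_Omega_pow[OF g] by blast
  then have "\<omega> g = (\<Prod>a=1..N. \<omega> (\<Omega> a) ^ \<alpha> a)"
    using omega_pm_eq[OF Omega_pow_in g] omega_pow_eq by (simp add: omega_pow_def)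
  then have "\<omega> g ^ Lcm (m ` {1..N}) = (\<Prod>a=1..N. (\<omega> (\<Omega> a) ^ Lcm (m ` {1..N})) ^ \<alpha> a)"
    by (simp add: prod_power_distrib power_mult[symmetric] mult.commute)
  also have "\<dots> = 1"
  proof (intro prod.neutral ballI)
    fix a
    assume a: "a \<in> {1..N}"
    then have "m a dvd Lcm (m ` {1..N})"
      by (intro dvd_Lcm) auto
    then obtain k where "Lcm (m ` {1..N}) = m a * k" ..
    then show "(\<omega> (\<Omega> a) ^ Lcm (m ` {1..N})) ^ \<alpha> a = 1"
      by (simp add: power_mult omega_Omega_m[OF a])
  qed
  finally show ?thesis .
qed

text \<open>Through this the congruence in \<open>F_set\<close> acts: weights matter only modulo
  \<open>m\<^sub>0\<close>.\<close>

lemma omega_powi_cong: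
  assumes g: "g \<in> G\<^sub>0" and cong: "[i = j] (mod int (Lcm (m ` {1..N})))"
  shows "\<omega> g powi i = \<omega> g powi j"
proof -
  obtain k where k: "i = j + int (Lcm (m ` {1..N})) * k"
    using cong cong_iff_lin[of j i] by (auto simp: cong_sym_eq)
  have "\<omega> g powi i = \<omega> g powi j * (\<omega> g powi int (Lcm (m ` {1..N}))) powi k"
    unfolding k using omega_nonzero[OF g] by (simp add: power_int_add power_int_mult)
  also have "\<dots> = \<omega> g powi j"
    using omega_pow_Lcm[OF g] by simp
  finally show ?thesis .
qed

end


subsection \<open>Matrices of formal power series\<close>

abbreviation mconst :: "complex ^ 'n ^ 'm \<Rightarrow> complex fps ^ 'n ^ 'm" where
  "mconst \<equiv> map_matrix fps_const"

abbreviation fscale :: "complex \<Rightarrow> complex fps ^ 'n ^ 'm \<Rightarrow> complex fps ^ 'n ^ 'm" where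
  "fscale c \<equiv> map_matrix ((*) (fps_const c))"

text \<open>Bridge between two views: products are formed for matrices of series, while the
  symmetries are conditions on the coefficient matrices.\<close>

definition mcoeff :: "complex fps ^ 'n ^ 'm \<Rightarrow> nat \<Rightarrow> complex ^ 'n ^ 'm" where
  "mcoeff S k = (\<chi> a b. fps_nth (S $ a $ b) k)"

primrec fpow :: "complex fps ^ 'm ^ 'm \<Rightarrow> nat \<Rightarrow> complex fps ^ 'm ^ 'm" where
  "fpow S 0 = mat 1"
| "fpow S (Suc n) = S ** fpow S n"

lemma mcoeff_nth: "mcoeff S k $ a $ b = fps_nth (S $ a $ b) k"
  by (simp add: mcoeff_def)

lemma mcoeff_eqI: "(\<And>k. mcoeff S k = mcoeff T k) \<Longrightarrow> S = T"
  by (simp add: vec_eq_iff fps_eq_iff mcoeff_def)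

lemma mcoeff_mult: "mcoeff (S ** T) k = (\<Sum>i\<le>k. mcoeff S i ** mcoeff T (k - i))"
  by (simp add: vec_eq_iff mcoeff_def matrix_matrix_mult_def fps_sum_nth fps_mult_nth
      sum.swap[of _ "{0..k}"] atMost_atLeast0)

lemma mcoeff_mconst: "mcoeff (mconst A) k = (if k = 0 then A else 0)"
  by (simp add: vec_eq_iff mcoeff_def)

lemma mcoeff_mconst_mult: "mcoeff (mconst A ** S) k = A ** mcoeff S k"
  by (simp add: vec_eq_iff mcoeff_def matrix_matrix_mult_def fps_sum_nth)

lemma mcoeff_mult_mconst: "mcoeff (S ** mconst A) k = mcoeff S k ** A"
  by (simp add: vec_eq_iff mcoeff_def matrix_matrix_mult_def fps_sum_nth)

lemma mcoeff_sum: "mcoeff (\<Sum>i\<in>I. S i) k = (\<Sum>i\<in>I. mcoeff (S i) k)"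
  by (simp add: vec_eq_iff mcoeff_def fps_sum_nth)

lemma mcoeff_transpose: "mcoeff (transpose S) k = transpose (mcoeff S k)"
  by (simp add: vec_eq_iff mcoeff_def transpose_def)

lemma mcoeff_fscale:
  "mcoeff (fscale c S) k = mscale c (mcoeff S k)"
  by (simp add: vec_eq_iff mcoeff_def)

lemma trace_mcoeff: "trace (mcoeff S k) = fps_nth (trace S) k"
  by (simp add: trace_def mcoeff_def fps_sum_nth)

lemma fpow_commute:
  assumes "X ** S = S ** X"
  shows "X ** fpow S n = fpow S n ** X"
proof (induction n)
  case (Suc n)
  then show ?case
    by (simp add: matrix_mul_assoc assms) (simp add: Suc flip: matrix_mul_assoc)
qed simp


subsection \<open>Expansions at infinity\<close>

text \<open>A power series suffices because L is regular at infinity; all growth comes from the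
  scalar factor \<open>l powi p\<close>, added in \<open>inf_coeff_expansion\<close> as a
  shift.\<close>

definition expands_at_infinity :: "(complex \<Rightarrow> complex ^ 'n ^ 'm) \<Rightarrow> complex fps ^ 'n ^ 'm \<Rightarrow> bool" where
  "expands_at_infinity Q S \<longleftrightarrow>
    (\<forall>a b. (\<lambda>z. Q (inverse z) $ a $ b) has_laurent_expansion fps_to_fls (S $ a $ b))"

lemma fps_to_fls_sum: "fps_to_fls (\<Sum>i\<in>I. F i) = (\<Sum>i\<in>I. fps_to_fls (F i :: complex fps))"
  by (induction I rule: infinite_finite_induct) (auto simp: fps_to_fls_plus)

lemma expands_const: "expands_at_infinity (\<lambda>_. A) (mconst A)"
  by (simp add: expands_at_infinity_def)

lemma expands_mult:
  assumes "expands_at_infinity P S" "expands_at_infinity Q T"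
  shows "expands_at_infinity (\<lambda>l. P l ** Q l) (S ** T)"
  using assms
  by (auto simp: expands_at_infinity_def matrix_matrix_mult_def fps_to_fls_sum fls_times_fps_to_fls
      intro!: laurent_expansion_intros)

lemma expands_sum:
  assumes "\<And>i. i \<in> I \<Longrightarrow> expands_at_infinity (Q i) (S i)"
  shows "expands_at_infinity (\<lambda>l. \<Sum>i\<in>I. Q i l) (\<Sum>i\<in>I. S i)"
  using assms by (auto simp: expands_at_infinity_def fps_to_fls_sum intro!: laurent_expansion_intros)

lemma expands_add:
  "expands_at_infinity P S \<Longrightarrow> expands_at_infinity Q T \<Longrightarrow> expands_at_infinity (\<lambda>l. P l + Q l) (S + T)"
  by (auto simp: expands_at_infinity_def intro!: laurent_expansion_intros)

lemma expands_mpow: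
  "expands_at_infinity Q S \<Longrightarrow> expands_at_infinity (\<lambda>l. mpow (Q l) n) (fpow S n)"
proof (induction n)
  case 0
  have one: "mconst (mat 1) = (mat 1 :: complex fps ^ 'a ^ 'a)"
    by (simp add: vec_eq_iff mat_def)
  then show ?case
    using expands_const[of "mat 1 :: complex ^ 'a ^ 'a"] by (simp add: one)
qed (auto intro: expands_mult)

lemma inf_coeff_expansion:
  assumes "expands_at_infinity Q S"
  shows "inf_coeff (\<lambda>l. mscale (l powi p) (Q l)) j = (if j \<le> p then mcoeff S (nat (p - j)) else 0)"
proof -
  have "laurent_expansion (\<lambda>z. mscale (inverse z powi p) (Q (inverse z)) $ a $ b) 0
    = fls_shift p (fps_to_fls (S $ a $ b))" for a b
  proof -
    have "(\<lambda>z. Q (inverse z) $ a $ b * z powi (- p)) has_laurent_expansion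
      fls_shift p (fps_to_fls (S $ a $ b))"
      using assms by (intro has_laurent_expansion_shift') (simp add: expands_at_infinity_def)
    then have "(\<lambda>z. mscale (inverse z powi p) (Q (inverse z)) $ a $ b) has_laurent_expansion
      fls_shift p (fps_to_fls (S $ a $ b))"
      by (simp add: power_int_minus power_int_inverse mult.commute)
    then show ?thesis
      using laurent_expansion_eqI[of _ 0] by simp
  qed
  then show ?thesis
    by (simp add: inf_coeff_def vec_eq_iff mcoeff_def)
qed

text \<open>The coefficient of \<lambda>^(-1) after multiplication by \<lambda>^p is that of
  z^(p+1), whence \<open>Suc\<close>.\<close>

lemma Res_expansion:
  assumes "expands_at_infinity Q S" "p \<ge> 0"
  shows "Res (\<lambda>l. mscale (l powi p) (Q l)) = mcoeff S (Suc (nat p))"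
  using assms by (simp add: Res_def inf_coeff_expansion nat_add_distrib)

lemma inf_plus_expansion:
  assumes "expands_at_infinity Q S" "p \<ge> 0"
  shows "inf_plus (\<lambda>l. mscale (l powi p) (Q l)) x
    = (\<Sum>k\<le>nat p. mscale (x ^ (nat p - k)) (mcoeff S k))"
proof -
  let ?c = "inf_coeff (\<lambda>l. mscale (l powi p) (Q l))"
  \<comment> \<open>Coefficients beyond \<lambda>^p vanish, so the sum over the support extends to
    0..p; then the index k = p - j counts powers of z.\<close>
  have "inf_plus (\<lambda>l. mscale (l powi p) (Q l)) x = (\<Sum>j\<in>{0..p}. mscale (x powi j) (?c j))"
    unfolding inf_plus_def
    by (rule sum.mono_neutral_left)
       (use assms in \<open>auto simp: inf_coeff_expansion vec_eq_iff split: if_splits\<close>)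
  also have "\<dots> = (\<Sum>k\<le>nat p. mscale (x ^ (nat p - k)) (mcoeff S k))"
  proof (rule sum.reindex_bij_witness[where i = "\<lambda>k. p - int k" and j = "\<lambda>j. nat (p - j)"])
    fix j
    assume j: "j \<in> {0..p}"
    then have "nat p - nat (p - j) = nat j"
      by auto
    then show "mscale (x ^ (nat p - nat (p - j))) (mcoeff S (nat (p - j))) = mscale (x powi j) (?c j)"
      using j unfolding inf_coeff_expansion[OF assms(1)] by (simp add: power_int_def)
  qed (use assms(2) in auto)
  finally show ?thesis .
qed

text \<open>The expansion 1 / (\<lambda> - c) = z / (1 - c z), a geometric series delayed by one
  power of z.\<close>

definition pole_series :: "complex \<Rightarrow> complex fps" where
  "pole_series c = Abs_fps (\<lambda>k. if k = 0 then 0 else c ^ (k - 1))"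

lemma pole_series_nth [simp]:
  "fps_nth (pole_series c) 0 = 0" "fps_nth (pole_series c) (Suc k) = c ^ k"
  by (simp_all add: pole_series_def)

lemma has_laurent_expansion_pole:
  "(\<lambda>z. 1 / (inverse z - c)) has_laurent_expansion fps_to_fls (pole_series c)"
proof -
  have "pole_series c * (1 - fps_const c * fps_X) = fps_X"
  proof (rule fps_ext)
    fix n
    have "fps_nth (pole_series c * (1 - fps_const c * fps_X)) n
      = fps_nth (pole_series c) n - c * fps_nth (pole_series c * fps_X) n"
      by (simp add: right_diff_distrib mult.left_commute[of _ "fps_const c"])
    also have "\<dots> = fps_nth fps_X n"
      by (cases n; cases "n - 1") auto
    finally show "fps_nth (pole_series c * (1 - fps_const c * fps_X)) n = fps_nth fps_X n" .
  qed
  moreover have "fps_nth (1 - fps_const c * fps_X) 0 = 1"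
    by simp
  then have "1 - fps_const c * fps_X \<noteq> 0"
    by (metis fps_zero_nth zero_neq_one)
  ultimately have eq: "pole_series c = fps_X / (1 - fps_const c * fps_X)"
    by (metis nonzero_mult_div_cancel_right)
  have "(\<lambda>z. z / (1 - c * z)) has_fps_expansion fps_X / (1 - fps_const c * fps_X)"
    by (intro fps_expansion_intros) auto
  then have "(\<lambda>z. z / (1 - c * z)) has_laurent_expansion fps_to_fls (pole_series c)"
    unfolding eq by (rule has_laurent_expansion_fps)
  moreover have ev: "eventually (\<lambda>z. z / (1 - c * z) = 1 / (inverse z - c)) (at 0)"
    using eventually_neq_at_within[of 0]
    by eventually_elim (simp add: divide_simps)
  ultimately show ?thesis
    using has_laurent_expansion_cong[OF ev refl] by simp
qed


subsection \<open>Derivatives of matrices of formal power series\<close>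

text \<open>Differentiation coefficient by coefficient: each coefficient of a product involves
  finitely many coefficients of the factors, so the Leibniz rule needs no convergence in z.\<close>

definition has_mderiv ::
  "('a::real_normed_vector \<Rightarrow> complex fps ^ 'n ^ 'm) \<Rightarrow> ('a \<Rightarrow> complex fps ^ 'n ^ 'm) \<Rightarrow> 'a \<Rightarrow> bool" where
  "has_mderiv S S' x \<longleftrightarrow> (\<forall>a b k. ((\<lambda>y. fps_nth (S y $ a $ b) k) has_derivative
     (\<lambda>d. fps_nth (S' d $ a $ b) k)) (at x))"

lemma has_mderiv_const: "has_mderiv (\<lambda>_. S) (\<lambda>_. 0) x"
  by (simp add: has_mderiv_def)

lemma has_mderiv_mult:
  assumes "has_mderiv S S' x" "has_mderiv T T' x"
  shows "has_mderiv (\<lambda>y. S y ** T y) (\<lambda>d. S x ** T' d + S' d ** T x) x"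
  unfolding has_mderiv_def
proof (intro allI)
  fix a b k
  have "((\<lambda>y. \<Sum>c\<in>UNIV. \<Sum>i\<le>k. fps_nth (S y $ a $ c) i * fps_nth (T y $ c $ b) (k - i)) has_derivative
      (\<lambda>d. \<Sum>c\<in>UNIV. \<Sum>i\<le>k. fps_nth (S x $ a $ c) i * fps_nth (T' d $ c $ b) (k - i)
        + fps_nth (S' d $ a $ c) i * fps_nth (T x $ c $ b) (k - i))) (at x)"
    using assms unfolding has_mderiv_def
    by (intro has_derivative_sum has_derivative_mult) auto
  then show "((\<lambda>y. fps_nth ((S y ** T y) $ a $ b) k) has_derivative
     (\<lambda>d. fps_nth ((S x ** T' d + S' d ** T x) $ a $ b) k)) (at x)"
    by (simp add: matrix_matrix_mult_def fps_sum_nth fps_mult_nth atMost_atLeast0 sum.distrib)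
qed

text \<open>The non-commutative derivative of the n-th power in direction \<open>D\<close>, that is,
  the sum of S^i D S^(n-1-i).\<close>

fun fpow_deriv :: "complex fps ^ 'm ^ 'm \<Rightarrow> complex fps ^ 'm ^ 'm \<Rightarrow> nat \<Rightarrow> complex fps ^ 'm ^ 'm" where
  "fpow_deriv S D 0 = 0"
| "fpow_deriv S D (Suc n) = S ** fpow_deriv S D n + D ** fpow S n"

lemma has_mderiv_fpow:
  assumes "has_mderiv S S' x"
  shows "has_mderiv (\<lambda>y. fpow (S y) n) (\<lambda>d. fpow_deriv (S x) (S' d) n) x"
  by (induction n) (auto intro: has_mderiv_const has_mderiv_mult assms)

text \<open>Under the trace all Leibniz terms coincide: cyclicity rotates the powers of
  \<open>S\<close> to one side of \<open>D\<close>, and they pass \<open>X\<close> because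
  \<open>X\<close> commutes with \<open>S\<close>.\<close>

lemma trace_fpow_deriv:
  assumes "X ** S = S ** X"
  shows "trace (X ** fpow_deriv S D (Suc n)) = of_nat (Suc n) * trace (X ** fpow S n ** D)"
  using assms
proof (induction n arbitrary: X)
  case 0
  show ?case
    by (simp add: matrix_mul_zero_right)
next
  case (Suc n)
  \<comment> \<open>The induction applies to \<open>X ** S\<close> in place of \<open>X\<close>,
    absorbing the factor that stands in front of the remaining derivative.\<close>
  have comm: "X ** S ** S = S ** (X ** S)"
    by (simp add: Suc.prems flip: matrix_mul_assoc)
  have "trace (X ** fpow_deriv S D (Suc (Suc n)))
    = trace ((X ** S) ** fpow_deriv S D (Suc n)) + trace (X ** (D ** fpow S (Suc n)))"
    by (simp only: fpow_deriv.simps(2)[of S D "Suc n"] matrix_add_ldistrib trace_add matrix_mul_assoc)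
  also have "trace (X ** (D ** fpow S (Suc n))) = trace (fpow S (Suc n) ** X ** D)"
    by (metis matrix_mul_assoc trace_mul_sym)
  also have "fpow S (Suc n) ** X = X ** fpow S (Suc n)"
    using fpow_commute[OF Suc.prems, of "Suc n"] by simp
  also have "trace ((X ** S) ** fpow_deriv S D (Suc n)) = of_nat (Suc n) * trace (X ** S ** fpow S n ** D)"
    by (rule Suc.IH) (rule comm)
  also have "X ** S ** fpow S n = X ** fpow S (Suc n)"
    by (simp add: matrix_mul_assoc)
  finally show ?case
    by (simp add: algebra_simps)
qed


subsection \<open>Scalar multiples, reality and transposition\<close>

lemma mscale_mult_left: "mscale c A ** B = mscale c (A ** B)"
  by (simp add: vec_eq_iff matrix_matrix_mult_def sum_distrib_left mult.assoc)

lemma mscale_mult_right: "A ** mscale c B = mscale c (A ** B)"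
  by (simp add: vec_eq_iff matrix_matrix_mult_def sum_distrib_left mult.left_commute)

lemma mscale_mscale: "mscale c (mscale d A) = mscale (c * d) A"
  by (simp add: vec_eq_iff mult.assoc)

lemma mscale_sum: "mscale c (\<Sum>i\<in>I. A i) = (\<Sum>i\<in>I. mscale c (A i))"
  by (simp add: vec_eq_iff sum_distrib_left)

lemma mscale_one: "mscale 1 A = A"
  by (simp add: vec_eq_iff)

lemma transpose_mscale: "transpose (mscale c A) = mscale c (transpose A)"
  by (simp add: vec_eq_iff transpose_def)

lemma transpose_sum: "transpose (\<Sum>i\<in>I. A i) = (\<Sum>i\<in>I. transpose (A i))"
  by (simp add: vec_eq_iff transpose_def)

lemma conj_mat_mscale: "conj_mat (mscale c A) = mscale (cnj c) (conj_mat A)"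
  by (simp add: vec_eq_iff)

lemma conj_mat_sum: "conj_mat (\<Sum>i\<in>I. A i) = (\<Sum>i\<in>I. conj_mat (A i))"
  by (simp add: vec_eq_iff)

lemma conj_mat_transpose: "conj_mat (transpose A) = transpose (conj_mat A)"
  by (simp add: vec_eq_iff transpose_def)

lemma conj_mat_cmat: "conj_mat (cmat A) = cmat A"
  by (simp add: vec_eq_iff)

lemma trace_mscale: "trace (mscale c A) = c * trace A"
  by (simp add: trace_def sum_distrib_left)

lemma trace_sum: "trace (\<Sum>i\<in>I. A i) = (\<Sum>i\<in>I. trace (A i))"
  by (simp add: trace_def sum.swap[of _ I])

lemma fscale_mult_left: "fscale c S ** T = fscale c (S ** T)"
  by (simp add: vec_eq_iff matrix_matrix_mult_def sum_distrib_left mult.assoc)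

lemma fscale_mult_right: "S ** fscale c T = fscale c (S ** T)"
  by (simp add: vec_eq_iff matrix_matrix_mult_def sum_distrib_left mult.left_commute)

definition real_coeffs :: "complex fps ^ 'n ^ 'm \<Rightarrow> bool" where
  "real_coeffs S \<longleftrightarrow> (\<forall>k. conj_mat (mcoeff S k) = mcoeff S k)"

lemma real_coeffs_mult: "real_coeffs S \<Longrightarrow> real_coeffs T \<Longrightarrow> real_coeffs (S ** T)"
  by (simp add: real_coeffs_def mcoeff_mult conj_mat_sum conj_mat_mul)

lemma mcoeff_mat_1: "mcoeff (mat 1) k = (if k = 0 then mat 1 else 0)"
  by (simp add: vec_eq_iff mcoeff_def mat_def)

lemma real_coeffs_fpow: "real_coeffs S \<Longrightarrow> real_coeffs (fpow S n)"
proof (induction n)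
  case 0
  show ?case
    by (simp add: real_coeffs_def mcoeff_mat_1) (simp add: vec_eq_iff mat_def)
qed (simp add: real_coeffs_mult)

lemma real_coeffs_mconst: "conj_mat A = A \<Longrightarrow> real_coeffs (mconst A)"
  by (simp add: real_coeffs_def mcoeff_mconst) (simp add: vec_eq_iff)

lemma real_coeffs_fscale: "real_coeffs S \<Longrightarrow> real_coeffs (fscale (of_real c) S)"
  by (simp add: real_coeffs_def mcoeff_fscale conj_mat_mscale)

lemma real_coeffs_sum: "(\<And>i. i \<in> I \<Longrightarrow> real_coeffs (S i)) \<Longrightarrow> real_coeffs (\<Sum>i\<in>I. S i)"
  by (simp add: real_coeffs_def mcoeff_sum conj_mat_sum)

text \<open>For c = -1 the coefficients lie in the Lie algebra, for c = 1 they satisfy the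
  transposition rule of \<open>Theta_set\<close>; the inverse of \<open>W\<close> is moved to the
  other side.\<close>

definition twisted :: "real ^ 'm ^ 'm \<Rightarrow> complex \<Rightarrow> complex fps ^ 'm ^ 'm \<Rightarrow> bool" where
  "twisted W c S \<longleftrightarrow>
    (\<forall>k. transpose (mcoeff S k) ** cmat W = mscale c (cmat W ** mcoeff S k))"

lemma twisted_fps:
  "twisted W c S \<longleftrightarrow> transpose S ** mconst (cmat W) = fscale c (mconst (cmat W) ** S)"
  (is "_ \<longleftrightarrow> ?L = ?R")
proof -
  have "mcoeff ?L k = transpose (mcoeff S k) ** cmat W"
    "mcoeff ?R k = mscale c (cmat W ** mcoeff S k)" for k
    by (simp_all add: mcoeff_mult_mconst mcoeff_mconst_mult mcoeff_fscale mcoeff_transpose)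
  then show ?thesis
    unfolding twisted_def by (metis mcoeff_eqI)
qed

text \<open>Transposition reverses the two factors and the commutation hypothesis restores their
  order, so the signs multiply.\<close>

lemma twisted_mult:
  assumes "twisted W c S" "twisted W d T" "S ** T = T ** S"
  shows "twisted W (c * d) (S ** T)"
proof -
  have "transpose (S ** T) ** mconst (cmat W) = transpose S ** (transpose T ** mconst (cmat W))"
    unfolding assms(3) by (simp add: matrix_transpose_mul matrix_mul_assoc)
  also have "\<dots> = fscale d ((transpose S ** mconst (cmat W)) ** T)"
    using assms(2) by (simp add: twisted_fps fscale_mult_right matrix_mul_assoc)
  also have "\<dots> = fscale (c * d) (mconst (cmat W) ** (S ** T))"
    using assms(1) by (simp add: twisted_fps fscale_mult_left matrix_mul_assoc)
      (simp add: vec_eq_iff mult_ac flip: fps_const_mult)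
  finally show ?thesis
    by (simp add: twisted_fps)
qed

lemma twisted_fpow:
  assumes "twisted W c S"
  shows "twisted W (c ^ n) (fpow S n)"
proof (induction n)
  case 0
  show ?case
    by (simp add: twisted_def mcoeff_mat_1) (simp add: vec_eq_iff transpose_def matrix_matrix_mult_def mat_def)
next
  case (Suc n)
  then show ?case
    using twisted_mult[OF assms Suc fpow_commute[OF refl]] by simp
qed

lemma twisted_fscale: "twisted W c S \<Longrightarrow> twisted W c (fscale d S)"
  by (simp add: twisted_def mcoeff_fscale transpose_mscale mscale_mult_left mscale_mult_right
      mscale_mscale mult.commute)

lemma twisted_sum: "(\<And>i. i \<in> I \<Longrightarrow> twisted W c (S i)) \<Longrightarrow> twisted W c (\<Sum>i\<in>I. S i)"
  by (simp add: twisted_def mcoeff_sum transpose_sum matrix_mul_sum_left matrix_mul_sum_right mscale_sum)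


subsection \<open>The Lax matrix as a power series in the inverse spectral parameter\<close>

context reduction_group
begin

text \<open>In terms of \<lambda> this reads g S(\<lambda>) g^(-1) = \<omega>(g)^d S(\<omega>(g)
  \<lambda>), which explains why weights add under products.\<close>

definition weight :: "int \<Rightarrow> complex fps ^ 'm ^ 'm \<Rightarrow> bool" where
  "weight d S \<longleftrightarrow> (\<forall>g\<in>G\<^sub>0. \<forall>k.
    g ** mcoeff S k ** matrix_inv g = mscale (\<omega> g powi (d - int k)) (mcoeff S k))"

lemma weight_mult:
  assumes "weight c S" "weight d T"
  shows "weight (c + d) (S ** T)"
  unfolding weight_def
proof (intro ballI allI)
  fix g k
  assume g: "g \<in> G\<^sub>0"
  have "g ** mcoeff (S ** T) k ** matrix_inv g = (\<Sum>i\<le>k. g ** (mcoeff S i ** mcoeff T (k - i)) ** matrix_inv g)"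
    by (simp add: mcoeff_mult matrix_mul_sum_left matrix_mul_sum_right)
  also have "\<dots> = (\<Sum>i\<le>k. mscale (\<omega> g powi (c + d - int k)) (mcoeff S i ** mcoeff T (k - i)))"
  proof (rule sum.cong)
    fix i
    assume "i \<in> {..k}"
    then have exps: "(c - int i) + (d - int (k - i)) = c + d - int k"
      by simp
    have "g ** (mcoeff S i ** mcoeff T (k - i)) ** matrix_inv g
      = (g ** mcoeff S i ** matrix_inv g) ** (g ** mcoeff T (k - i) ** matrix_inv g)"
      by (metis G0_cancel(2)[OF g] matrix_mul_assoc matrix_mul_rid)
    also have "\<dots> = mscale (\<omega> g powi ((c - int i) + (d - int (k - i)))) (mcoeff S i ** mcoeff T (k - i))"
      using assms g omega_nonzero[OF g]
      by (simp add: weight_def mscale_mult_left mscale_mult_right mscale_mscale power_int_add mult.commute)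
    finally show "g ** (mcoeff S i ** mcoeff T (k - i)) ** matrix_inv g
      = mscale (\<omega> g powi (c + d - int k)) (mcoeff S i ** mcoeff T (k - i))"
      unfolding exps .
  qed simp
  finally show "g ** mcoeff (S ** T) k ** matrix_inv g
      = mscale (\<omega> g powi (c + d - int k)) (mcoeff (S ** T) k)"
    by (simp add: mcoeff_mult mscale_sum)
qed

lemma weight_one: "weight 0 (mat 1)"
  by (auto simp: weight_def mcoeff_mat_1 G0_cancel mscale_one matrix_mul_zero_right
      matrix_mul_zero_left)
     (auto simp: vec_eq_iff)

lemma weight_fpow: "weight 1 S \<Longrightarrow> weight (int n) (fpow S n)"
proof (induction n)
  case (Suc n)
  then show ?case
    using weight_mult[of 1 S "int n" "fpow S n"] by simp
qed (simp add: weight_one)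

lemma weight_fscale: "weight d S \<Longrightarrow> weight d (fscale c S)"
  by (simp add: weight_def mcoeff_fscale mscale_mult_left mscale_mult_right mscale_mscale mult.commute)

lemma weight_sum: "(\<And>i. i \<in> I \<Longrightarrow> weight d (S i)) \<Longrightarrow> weight d (\<Sum>i\<in>I. S i)"
  by (simp add: weight_def mcoeff_sum matrix_mul_sum_left matrix_mul_sum_right mscale_sum)

text \<open>Linear in a free family \<open>Q\<close> of matrices: with the products \<Phi>\<Phi>^T
  it is the polar part of L, with their variations it is \<delta>L.\<close>

definition pole_part ::
  "real \<Rightarrow> ('r::finite \<Rightarrow> real) \<Rightarrow> ('r \<Rightarrow> real ^ 'm ^ 'm) \<Rightarrow> complex fps ^ 'm ^ 'm" where
  "pole_part c lam Q = (\<Sum>g\<in>G\<^sub>0. \<Sum>\<sigma>\<in>UNIV.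
     map_matrix (\<lambda>x. pole_series (\<omega> g * of_real (lam \<sigma>)) * fps_const (of_real c * x))
       (g ** cmat (Q \<sigma>) ** transpose g ** cmat W))"

lemma mcoeff_pole_part:
  "mcoeff (pole_part c lam Q) 0 = 0"
  "mcoeff (pole_part c lam Q) (Suc k) = (\<Sum>g\<in>G\<^sub>0. \<Sum>\<sigma>\<in>UNIV.
     mscale (of_real c * (\<omega> g * of_real (lam \<sigma>)) ^ k) (g ** cmat (Q \<sigma>) ** transpose g ** cmat W))"
  by (simp_all add: pole_part_def mcoeff_sum)
     (simp_all add: mcoeff_def vec_eq_iff mult_ac)

lemma expands_pole_part:
  "expands_at_infinity (\<lambda>l. \<Sum>g\<in>G\<^sub>0. \<Sum>\<sigma>\<in>UNIV.
     mscale (of_real c * (1 / (l - \<omega> g * of_real (lam \<sigma>)))) (g ** cmat (Q \<sigma>) ** transpose g ** cmat W))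
   (pole_part c lam Q)"
  unfolding pole_part_def
proof (intro expands_sum)
  fix g \<sigma>
  define A where "A = g ** cmat (Q \<sigma>) ** transpose g ** cmat W"
  have "(\<lambda>z. (of_real c * A $ a $ b) * (1 / (inverse z - \<omega> g * of_real (lam \<sigma>)))) has_laurent_expansion
    fls_const (of_real c * A $ a $ b) * fps_to_fls (pole_series (\<omega> g * of_real (lam \<sigma>)))" for a b
    by (intro has_laurent_expansion_cmult_left has_laurent_expansion_pole)
  then show "expands_at_infinity (\<lambda>l. mscale (of_real c * (1 / (l - \<omega> g * of_real (lam \<sigma>)))) A)
    (map_matrix (\<lambda>x. pole_series (\<omega> g * of_real (lam \<sigma>)) * fps_const (of_real c * x)) A)"
    by (simp add: expands_at_infinity_def fls_times_fps_to_fls mult_ac)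
qed

text \<open>The group condition trades the transpose for an inverse, so every pole carries a
  conjugate of one fixed matrix; equivariance rests on this form.\<close>

lemma G0_conjugation: "g \<in> G\<^sub>0 \<Longrightarrow> g ** A ** transpose g ** cmat W = g ** (A ** cmat W) ** matrix_inv g"
  using G0_transpose[of g] by (metis matrix_mul_assoc)

text \<open>Conjugation by \<open>u\<close> sends the summand of \<open>g\<close> to that of
  \<open>u ** g\<close>, and the sum over \<open>G\<^sub>0\<close> is reindexed accordingly.\<close>

lemma weight_pole_part: "weight 1 (pole_part c lam Q)"
  unfolding weight_def
proof (intro ballI allI)
  fix u k
  assume u: "u \<in> G\<^sub>0"
  show "u ** mcoeff (pole_part c lam Q) k ** matrix_inv u
    = mscale (\<omega> u powi (1 - int k)) (mcoeff (pole_part c lam Q) k)"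
  proof (cases k)
    case 0
    then show ?thesis
      by (simp add: mcoeff_pole_part(1) matrix_mul_zero_right matrix_mul_zero_left) (simp add: vec_eq_iff)
  next
    case (Suc j)
    define P where "P (g :: complex ^ 'm ^ 'm) \<sigma> = g ** (cmat (Q \<sigma>) ** cmat W) ** matrix_inv g" for g \<sigma>
    define r where "r g \<sigma> = complex_of_real c * (\<omega> g * of_real (lam \<sigma>)) ^ j" for g \<sigma>
    have coeff: "mcoeff (pole_part c lam Q) k = (\<Sum>g\<in>G\<^sub>0. \<Sum>\<sigma>\<in>UNIV. mscale (r g \<sigma>) (P g \<sigma>))"
      by (simp add: Suc mcoeff_pole_part(2) P_def r_def G0_conjugation)
    have shift: "u ** P g \<sigma> ** matrix_inv u = P (u ** g) \<sigma>" if "g \<in> G\<^sub>0" for g \<sigma>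
      using that u by (simp add: P_def matrix_inv_mult matrix_mul_assoc)
    \<comment> \<open>With k = j + 1 the factor is the inverse of \<omega>(u)^j, exactly what the
      j-th power of the shifted pole contributes.\<close>
    have scal: "\<omega> u powi (1 - int k) * r (u ** g) \<sigma> = r g \<sigma>" if "g \<in> G\<^sub>0" for g \<sigma>
      using omega_nonzero[OF u] that u
      by (simp add: Suc r_def omega_mult power_mult_distrib power_int_minus field_simps)
    have "mscale (\<omega> u powi (1 - int k)) (mcoeff (pole_part c lam Q) k)
      = mscale (\<omega> u powi (1 - int k)) (\<Sum>g\<in>G\<^sub>0. \<Sum>\<sigma>\<in>UNIV. mscale (r (u ** g) \<sigma>) (P (u ** g) \<sigma>))"
      unfolding coeff by (subst sum.reindex_bij_betw[OF bij_betw_G0_mult[OF u], symmetric]) simp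
    also have "\<dots> = (\<Sum>g\<in>G\<^sub>0. \<Sum>\<sigma>\<in>UNIV. mscale (r g \<sigma>) (P (u ** g) \<sigma>))"
      by (simp add: mscale_sum mscale_mscale scal)
    also have "\<dots> = u ** mcoeff (pole_part c lam Q) k ** matrix_inv u"
      unfolding coeff
      by (simp add: matrix_mul_sum_left matrix_mul_sum_right mscale_mult_left mscale_mult_right shift)
    finally show ?thesis ..
  qed
qed

text \<open>Conjugation exchanges the summands of \<open>g\<close> and its inverse. The undetermined
  sign disappears because \<open>g\<close> enters each summand twice.\<close>

lemma real_coeffs_pole_part: "real_coeffs (pole_part c lam Q)"
  unfolding real_coeffs_def
proof
  fix k
  show "conj_mat (mcoeff (pole_part c lam Q) k) = mcoeff (pole_part c lam Q) k"
  proof (cases k)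
    case 0
    then show ?thesis
      by (simp add: mcoeff_pole_part(1)) (simp add: vec_eq_iff)
  next
    case (Suc j)
    define P where "P (g :: complex ^ 'm ^ 'm) \<sigma> = g ** cmat (Q \<sigma>) ** transpose g ** cmat W" for g \<sigma>
    have conj: "conj_mat (P g \<sigma>) = P (matrix_inv g) \<sigma>" if "g \<in> G\<^sub>0" for g \<sigma>
      using conj_G0[OF that]
      by (auto simp: P_def pm_eq_def conj_mat_mul conj_mat_transpose conj_mat_cmat transpose_uminus
          matrix_mul_uminus_left matrix_mul_uminus_right)
    have "conj_mat (mcoeff (pole_part c lam Q) k) = (\<Sum>g\<in>G\<^sub>0. \<Sum>\<sigma>\<in>UNIV.
        mscale (of_real c * (\<omega> (matrix_inv g) * of_real (lam \<sigma>)) ^ j) (P (matrix_inv g) \<sigma>))"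
      unfolding Suc mcoeff_pole_part(2) P_def[symmetric]
      by (simp add: conj_mat_sum conj_mat_mscale conj omega_inv)
    also have "\<dots> = mcoeff (pole_part c lam Q) k"
      unfolding Suc mcoeff_pole_part(2) P_def[symmetric]
      by (rule sum.reindex_bij_betw[OF bij_betw_G0_inv])
    finally show ?thesis .
  qed
qed

lemma transpose_cmat_W: "transpose (cmat W) = - cmat W"
proof -
  have "transpose (cmat W) = cmat (transpose W)"
    by (simp add: vec_eq_iff transpose_def)
  then show ?thesis
    by (simp add: W_antisym vec_eq_iff)
qed

text \<open>This holds summand by summand: each is a symmetric matrix times the antisymmetric
  \<open>W\<close>.\<close>

lemma twisted_pole_part:
  assumes "\<And>\<sigma>. transpose (Q \<sigma>) = Q \<sigma>"
  shows "twisted W (- 1) (pole_part c lam Q)"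
  unfolding twisted_def
proof
  fix k
  show "transpose (mcoeff (pole_part c lam Q) k) ** cmat W
    = mscale (- 1) (cmat W ** mcoeff (pole_part c lam Q) k)"
  proof (cases k)
    case 0
    then show ?thesis
      by (simp add: mcoeff_pole_part(1)) (simp add: vec_eq_iff matrix_matrix_mult_def transpose_def)
  next
    case (Suc j)
    have "transpose (cmat (Q \<sigma>)) = cmat (transpose (Q \<sigma>))" for \<sigma>
      by (simp add: vec_eq_iff transpose_def)
    then have sym: "transpose (cmat (Q \<sigma>)) = cmat (Q \<sigma>)" for \<sigma>
      by (simp add: assms)
    have "transpose (g ** cmat (Q \<sigma>) ** transpose g ** cmat W) ** cmat W
      = mscale (- 1) (cmat W ** (g ** cmat (Q \<sigma>) ** transpose g ** cmat W))" for g \<sigma>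
      by (simp add: matrix_transpose_mul transpose_cmat_W sym matrix_mul_uminus_left matrix_mul_assoc)
         (simp add: vec_eq_iff)
    then show ?thesis
      unfolding Suc mcoeff_pole_part(2)
      by (simp add: transpose_sum transpose_mscale matrix_mul_sum_left matrix_mul_sum_right
          mscale_mult_left mscale_mult_right mscale_sum mscale_mscale mult.commute)
  qed
qed

lemma W_cancel: "cmat W ** matrix_inv (cmat W) = mat 1" "matrix_inv (cmat W) ** cmat W = mat 1"
proof -
  have "cmat W ** cmat (matrix_inv W) = cmat (W ** matrix_inv W)"
    by (simp add: vec_eq_iff matrix_matrix_mult_def)
  also have "\<dots> = mat 1"
    by (simp add: matrix_inv_cancel[OF W_invertible]) (simp add: vec_eq_iff mat_def)
  finally have "invertible (cmat W)"
    using invertible_right_inverse by blast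
  then show "cmat W ** matrix_inv (cmat W) = mat 1" "matrix_inv (cmat W) ** cmat W = mat 1"
    by (auto simp: matrix_inv_cancel)
qed

lemma weight_mconst:
  assumes "\<And>g. g \<in> G\<^sub>0 \<Longrightarrow> g ** A ** matrix_inv g = mscale (\<omega> g powi d) A"
  shows "weight d (mconst A)"
  using assms by (auto simp: weight_def mcoeff_mconst matrix_mul_zero_right matrix_mul_zero_left)
    (auto simp: vec_eq_iff)

lemma D_set_1:
  assumes "K \<in> D_set W G\<^sub>0 \<omega> 1"
  shows "weight 1 (mconst K)" "real_coeffs (mconst K)" "twisted W (- 1) (mconst K)"
proof -
  show "weight 1 (mconst K)"
    using assms by (intro weight_mconst) (auto simp: D_set_def)
  show "real_coeffs (mconst K)"
    using assms by (intro real_coeffs_mconst) (auto simp: D_set_def)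
  have "transpose K = - (cmat W ** K ** matrix_inv (cmat W))"
    using assms by (auto simp: D_set_def gW_def)
  then have "transpose K ** cmat W = - (cmat W ** K)"
    by (simp add: matrix_mul_uminus_left W_cancel flip: matrix_mul_assoc)
  then show "twisted W (- 1) (mconst K)"
    by (simp add: twisted_def mcoeff_mconst)
       (simp add: vec_eq_iff matrix_matrix_mult_def transpose_def)
qed

definition lax_series ::
  "complex ^ 'm ^ 'm \<Rightarrow> real \<Rightarrow> ('r::finite \<Rightarrow> real) \<Rightarrow> ('r \<Rightarrow> real ^ 'm ^ 'm) \<Rightarrow> complex fps ^ 'm ^ 'm" where
  "lax_series K c lam Q = mconst K + pole_part c lam Q"

lemma lax_series:
  assumes K: "K \<in> D_set W G\<^sub>0 \<omega> 1" and Q: "\<And>\<sigma>. transpose (Q \<sigma>) = Q \<sigma>"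
  shows "weight 1 (lax_series K c lam Q)" "real_coeffs (lax_series K c lam Q)"
    "twisted W (- 1) (lax_series K c lam Q)"
proof -
  \<comment> \<open>Writing the two terms as a sum over the booleans lets the closure rules for
    finite sums cover this addition.\<close>
  have sum: "lax_series K c lam Q = (\<Sum>b\<in>UNIV. if b then mconst K else pole_part c lam Q)"
    by (simp add: lax_series_def UNIV_bool add.commute)
  show "weight 1 (lax_series K c lam Q)" "real_coeffs (lax_series K c lam Q)"
    "twisted W (- 1) (lax_series K c lam Q)"
    unfolding sum
    by (intro weight_sum real_coeffs_sum twisted_sum;
        simp add: D_set_1[OF K] weight_pole_part real_coeffs_pole_part twisted_pole_part[OF Q])+
qed

lemma Theta_set:
  assumes "\<theta> \<in> Theta_set W G\<^sub>0 \<omega> h"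
  shows "weight h (mconst \<theta>)" "real_coeffs (mconst \<theta>)" "twisted W 1 (mconst \<theta>)"
proof -
  show "weight h (mconst \<theta>)"
    using assms by (intro weight_mconst) (auto simp: Theta_set_def)
  show "real_coeffs (mconst \<theta>)"
    using assms by (intro real_coeffs_mconst) (auto simp: Theta_set_def)
  have "transpose \<theta> = cmat W ** \<theta> ** matrix_inv (cmat W)"
    using assms by (auto simp: Theta_set_def)
  then have "transpose \<theta> ** cmat W = cmat W ** \<theta>"
    by (simp add: W_cancel flip: matrix_mul_assoc)
  then show "twisted W 1 (mconst \<theta>)"
    by (simp add: twisted_def mcoeff_mconst mscale_one)
       (simp add: vec_eq_iff matrix_matrix_mult_def transpose_def)
qed

text \<open>Conjugation by an element of \<open>G\<^sub>0\<close> in the kernel of \<open>\<omega>\<close> fixes every series of pure weight.\<close>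

lemma Theta_set_commute:
  assumes \<theta>: "\<theta> \<in> Theta_set W G\<^sub>0 \<omega> h" and S: "weight d S"
  shows "mconst \<theta> ** S = S ** mconst \<theta>"
proof (rule mcoeff_eqI)
  fix k
  obtain c g where g: "g \<in> G\<^sub>0" "\<theta> = mscale c g" "\<omega> g = 1"
    using \<theta> by (auto simp: Theta_set_def)
  have "g ** mcoeff S k ** matrix_inv g = mcoeff S k"
    using S g by (simp add: weight_def mscale_one)
  then have "g ** mcoeff S k = mcoeff S k ** g"
    by (metis G0_cancel(2)[OF g(1)] matrix_mul_assoc matrix_mul_rid)
  then show "mcoeff (mconst \<theta> ** S) k = mcoeff (S ** mconst \<theta>) k"
    by (simp add: g(2) mcoeff_mconst_mult mcoeff_mult_mconst mscale_mult_left mscale_mult_right)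
qed

text \<open>The sum over \<open>G\<^sub>0\<close> in the polar part of \<open>L\<close> collapses, because the weights of
  \<open>S\<close> and of the polar part add up to cancel every \<open>\<omega> g\<close>.\<close>

lemma trace_mult_pole_part:
  assumes S: "weight (int p) S"
  shows "fps_nth (trace (S ** pole_part c lam Q)) (Suc p)
    = of_real (c * real (card G\<^sub>0)) * (\<Sum>\<sigma>\<in>UNIV.
        trace ((\<Sum>k\<le>p. mscale (of_real (lam \<sigma>) ^ (p - k)) (mcoeff S k)) ** cmat (Q \<sigma>) ** cmat W))"
proof -
  have summand: "trace (mcoeff S k ** mscale (of_real c * (\<omega> g * of_real (lam \<sigma>)) ^ (p - k))
      (g ** cmat (Q \<sigma>) ** transpose g ** cmat W))
    = of_real c * (of_real (lam \<sigma>) ^ (p - k) * trace (mcoeff S k ** cmat (Q \<sigma>) ** cmat W))"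
    if g: "g \<in> G\<^sub>0" and k: "k \<le> p" for g k \<sigma>
  proof -
    \<comment> \<open>Cyclicity will move the conjugation from the pole onto \<open>S\<close>, where
      the weight yields the conjugate of \<omega>(g)^(p-k); the pole supplies \<omega>(g)^(p-k), so
      the two cancel.\<close>
    have "matrix_inv g ** mcoeff S k ** g = mscale (cnj (\<omega> g) powi (int p - int k)) (mcoeff S k)"
      using S G0_inv[OF g] by (simp add: weight_def omega_inv[OF g, symmetric])
         (metis matrix_inv_inv[OF g])
    then have conj: "matrix_inv g ** mcoeff S k ** g = mscale (cnj (\<omega> g) ^ (p - k)) (mcoeff S k)"
      using k by (simp flip: of_nat_diff)
    have "\<omega> g * cnj (\<omega> g) = 1"
      using cmod_omega[OF g] by (simp add: complex_norm_square[symmetric])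
    then have unit: "\<omega> g ^ (p - k) * cnj (\<omega> g) ^ (p - k) = 1"
      by (simp flip: power_mult_distrib)
    have "trace (mcoeff S k ** (g ** cmat (Q \<sigma>) ** transpose g ** cmat W))
      = trace ((mcoeff S k ** g ** (cmat (Q \<sigma>) ** cmat W)) ** matrix_inv g)"
      using G0_conjugation[OF g, of "cmat (Q \<sigma>)"] by (simp add: matrix_mul_assoc)
    also have "\<dots> = trace (matrix_inv g ** mcoeff S k ** g ** (cmat (Q \<sigma>) ** cmat W))"
      by (subst trace_mul_sym) (simp add: matrix_mul_assoc)
    also have "\<dots> = cnj (\<omega> g) ^ (p - k) * trace (mcoeff S k ** cmat (Q \<sigma>) ** cmat W)"
      unfolding conj by (simp add: mscale_mult_left trace_mscale matrix_mul_assoc)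
    finally have "trace (mcoeff S k ** mscale (of_real c * (\<omega> g * of_real (lam \<sigma>)) ^ (p - k))
        (g ** cmat (Q \<sigma>) ** transpose g ** cmat W))
      = of_real c * (of_real (lam \<sigma>) ^ (p - k) * ((\<omega> g ^ (p - k) * cnj (\<omega> g) ^ (p - k))
          * trace (mcoeff S k ** cmat (Q \<sigma>) ** cmat W)))"
      by (simp add: mscale_mult_right trace_mscale power_mult_distrib mult_ac)
    then show ?thesis
      by (simp add: unit)
  qed
  have "fps_nth (trace (S ** pole_part c lam Q)) (Suc p)
    = (\<Sum>k\<le>Suc p. trace (mcoeff S k ** mcoeff (pole_part c lam Q) (Suc p - k)))"
    by (simp add: trace_mcoeff[symmetric] mcoeff_mult trace_sum del: sum.atMost_Suc)
  \<comment> \<open>The index k = p + 1 drops out: it pairs with the constant coefficient of the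
    polar part, which is zero.\<close>
  also have "\<dots> = (\<Sum>k\<le>p. trace (mcoeff S k ** mcoeff (pole_part c lam Q) (Suc (p - k))))"
    by (simp add: mcoeff_pole_part(1) matrix_mul_zero_right Suc_diff_le) (simp add: trace_def)
  also have "\<dots> = (\<Sum>k\<le>p. \<Sum>g\<in>G\<^sub>0. \<Sum>\<sigma>\<in>UNIV. of_real c *
      (of_real (lam \<sigma>) ^ (p - k) * trace (mcoeff S k ** cmat (Q \<sigma>) ** cmat W)))"
    by (intro sum.cong refl) (simp add: mcoeff_pole_part(2) matrix_mul_sum_right trace_sum summand)
  also have "\<dots> = of_real (c * real (card G\<^sub>0)) * (\<Sum>\<sigma>\<in>UNIV. \<Sum>k\<le>p.
      of_real (lam \<sigma>) ^ (p - k) * trace (mcoeff S k ** cmat (Q \<sigma>) ** cmat W))"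
    by (subst (3) sum.swap) (simp add: sum_distrib_left mult_ac)
  also have "\<dots> = of_real (c * real (card G\<^sub>0)) * (\<Sum>\<sigma>\<in>UNIV.
        trace ((\<Sum>k\<le>p. mscale (of_real (lam \<sigma>) ^ (p - k)) (mcoeff S k)) ** cmat (Q \<sigma>) ** cmat W))"
    by (simp add: matrix_mul_sum_left trace_sum mscale_mult_left trace_mscale)
  finally show ?thesis .
qed

end


subsection \<open>Matrix-valued polynomials\<close>

lemma mpoly_mat_eq:
  assumes "\<And>i. i \<ge> n \<Longrightarrow> Polynomial.coeff f i = 0"
  shows "mpoly_mat f X = (\<Sum>i<n. Polynomial.coeff f i ** mpow X i)"
proof (cases "f = 0")
  case True
  then show ?thesis
    by (simp add: mpoly_mat_def matrix_mul_zero_left)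
next
  case False
  then have "Polynomial.degree f < n"
    using assms leading_coeff_neq_0[of f] by (meson not_le)
  then show ?thesis
    unfolding mpoly_mat_def
    by (intro sum.mono_neutral_left) (auto simp: coeff_eq_0 matrix_mul_zero_left)
qed

text \<open>Entrywise passage to scalar polynomials, where the formal derivative and finiteness of
  the set of roots can be applied.\<close>

definition entry_poly :: "(complex ^ 'm ^ 'm) poly \<Rightarrow> 'm \<Rightarrow> 'm \<Rightarrow> complex poly" where
  "entry_poly f a b = map_poly (\<lambda>A. A $ a $ b) f"

lemma coeff_entry_poly: "Polynomial.coeff (entry_poly f a b) i = Polynomial.coeff f i $ a $ b"
  by (simp add: entry_poly_def coeff_map_poly)

lemma poly_entry_poly: "poly (entry_poly f a b) (of_real \<tau>) = mpoly_at f \<tau> $ a $ b"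
proof -
  have deg: "Polynomial.degree (entry_poly f a b) \<le> Polynomial.degree f"
    by (intro degree_le) (auto simp: coeff_entry_poly coeff_eq_0)
  have "poly (entry_poly f a b) (of_real \<tau>)
    = (\<Sum>i\<le>Polynomial.degree (entry_poly f a b). Polynomial.coeff (entry_poly f a b) i * of_real \<tau> ^ i)"
    by (rule poly_altdef)
  also have "\<dots> = (\<Sum>i\<le>Polynomial.degree f. Polynomial.coeff (entry_poly f a b) i * of_real \<tau> ^ i)"
    using deg by (intro sum.mono_neutral_left) (auto simp: not_le coeff_eq_0)
  also have "\<dots> = mpoly_at f \<tau> $ a $ b"
    by (simp add: mpoly_at_def coeff_entry_poly scaleR_conv_of_real[where 'a = complex] mult.commute)
  finally show ?thesis .
qed

text \<open>\<open>F\<close> is given only analytically. Entrywise, its formal derivative and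
  \<open>f\<close> agree at all real points, hence as polynomials; the value at 0 fixes the constant
  term.\<close>

lemma mpoly_antiderivative_coeff:
  assumes deriv: "\<And>\<tau>. (mpoly_at F has_vector_derivative mpoly_at f \<tau>) (at \<tau>)"
    and zero: "mpoly_at F 0 = 0"
  shows "Polynomial.coeff F 0 = 0"
    and "Polynomial.coeff F (Suc i) = (1 / real (Suc i)) *\<^sub>R Polynomial.coeff f i"
proof -
  have pderiv: "pderiv (entry_poly F a b) = entry_poly f a b" for a b
  proof -
    have "poly (pderiv (entry_poly F a b)) (of_real \<tau>) = poly (entry_poly f a b) (of_real \<tau>)" for \<tau>
    proof -
      have "((\<lambda>\<tau>. mpoly_at F \<tau> $ a $ b) has_vector_derivative mpoly_at f \<tau> $ a $ b) (at \<tau>)"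
        by (intro bounded_linear.has_vector_derivative[OF bounded_linear_vec_nth] deriv)
      then have "((\<lambda>\<tau>. poly (entry_poly F a b) (of_real \<tau>)) has_vector_derivative
          poly (entry_poly f a b) (of_real \<tau>)) (at \<tau>)"
        by (simp add: poly_entry_poly)
      moreover have "((\<lambda>\<tau>. poly (entry_poly F a b) (of_real \<tau>)) has_vector_derivative
          poly (pderiv (entry_poly F a b)) (of_real \<tau>)) (at \<tau>)"
        by (rule has_vector_derivative_real_field) (rule poly_DERIV)
      ultimately show ?thesis
        by (rule vector_derivative_unique_at[rotated])
    qed
    then have "range complex_of_real \<subseteq> {x. poly (pderiv (entry_poly F a b) - entry_poly f a b) x = 0}"
      by auto
    moreover have "infinite (range complex_of_real)"
      using infinite_UNIV_char_0 finite_imageD[of complex_of_real UNIV] by (auto simp: inj_def)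
    ultimately have "pderiv (entry_poly F a b) - entry_poly f a b = 0"
      using poly_roots_finite finite_subset by blast
    then show ?thesis
      by simp
  qed
  have "Polynomial.coeff F 0 $ a $ b = 0" for a b
    using poly_entry_poly[of F a b 0] zero by (simp add: poly_0_coeff_0 coeff_entry_poly)
  then show "Polynomial.coeff F 0 = 0"
    by (simp add: vec_eq_iff)
  have eq: "of_nat (Suc i) * Polynomial.coeff F (Suc i) $ a $ b = Polynomial.coeff f i $ a $ b" for a b
    using arg_cong[OF pderiv, of "\<lambda>q. Polynomial.coeff q i" a b]
    by (simp only: coeff_pderiv coeff_entry_poly)
  then show "Polynomial.coeff F (Suc i) = (1 / real (Suc i)) *\<^sub>R Polynomial.coeff f i"
    by (simp add: vec_eq_iff scaleR_conv_of_real[where 'a = complex] flip: eq del: of_nat_Suc)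
qed

text \<open>Reindexing by the exponent i = j - 1: even j become odd powers, and h + j \<equiv> p + 1
  becomes h + i \<equiv> p.\<close>

lemma F_set_cases:
  assumes "f \<in> F_set W G\<^sub>0 \<omega> m\<^sub>0 p h"
  obtains s \<theta> and a :: "nat \<Rightarrow> real" where "\<theta> \<in> Theta_set W G\<^sub>0 \<omega> h"
    "\<And>i. i < s \<Longrightarrow> a i \<noteq> 0 \<Longrightarrow> odd i \<and> [h + int i = p] (mod int m\<^sub>0)"
    "\<And>i. Polynomial.coeff f i = (if i < s then a i *\<^sub>R \<theta> else 0)"
proof -
  obtain s \<theta> and c :: "nat \<Rightarrow> real" where \<theta>: "\<theta> \<in> Theta_set W G\<^sub>0 \<omega> h"
    and c: "\<And>j. j \<in> {1..s} \<Longrightarrow> c (s - j) \<noteq> 0 \<Longrightarrow> even j \<and> [h + int j = p + 1] (mod int m\<^sub>0)"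
    and f: "f = (\<Sum>j=1..s. Polynomial.monom (c (s - j) *\<^sub>R \<theta>) (j - 1))"
    using assms unfolding F_set_def by blast
  have f': "f = (\<Sum>i<s. Polynomial.monom (c (s - Suc i) *\<^sub>R \<theta>) i)"
    unfolding f by (rule sum.reindex_bij_witness[where i = Suc and j = "\<lambda>j. j - 1"]) auto
  show thesis
  proof (rule that[OF \<theta>, where s = s and a = "\<lambda>i. c (s - Suc i)"])
    fix i
    assume i: "i < s" "c (s - Suc i) \<noteq> 0"
    from c[of "Suc i"] i have *: "even (Suc i)" "[h + int (Suc i) = p + 1] (mod int m\<^sub>0)"
      by auto
    have "h + int (Suc i) = (h + int i) + 1"
      by simp
    with * have "[h + int i = p] (mod int m\<^sub>0)"
      by (simp only: cong_add_rcancel)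
    with * show "odd i \<and> [h + int i = p] (mod int m\<^sub>0)"
      by simp
  next
    fix i
    show "Polynomial.coeff f i = (if i < s then c (s - Suc i) *\<^sub>R \<theta> else 0)"
      unfolding f' by (simp add: Polynomial.coeff_sum if_distrib cong: if_cong)
  qed
qed


subsection \<open>Real and complex vectors\<close>

lemma cmat_mult_cvec: "cmat A *v cvec u = cvec (A *v u)"
  by (simp add: vec_eq_iff cvec_def matrix_vector_mult_def)

text \<open>Both \<open>cvec\<close> and the entrywise real part are bounded linear, and the latter
  undoes the former. This identifies solutions of the complex-valued flow with solutions of the real
  one.\<close>

lemma has_vector_derivative_cvec_iff:
  "((\<lambda>x. cvec (\<phi> x)) has_vector_derivative cvec d) (at x within I)
    \<longleftrightarrow> (\<phi> has_vector_derivative d) (at x within I)"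
proof
  define re where "re v = (\<chi> i. Re (v $ i))" for v :: "complex ^ 'a"
  have "linear re"
    by (auto simp: linear_iff re_def vec_eq_iff)
  then have "bounded_linear re"
    by (simp add: linear_conv_bounded_linear)
  moreover assume "((\<lambda>x. cvec (\<phi> x)) has_vector_derivative cvec d) (at x within I)"
  ultimately have "((\<lambda>x. re (cvec (\<phi> x))) has_vector_derivative re (cvec d)) (at x within I)"
    by (rule bounded_linear.has_vector_derivative)
  then show "(\<phi> has_vector_derivative d) (at x within I)"
    by (simp add: re_def cvec_def)
next
  have "linear (cvec :: real ^ 'a \<Rightarrow> _)"
    by (auto simp: linear_iff cvec_def vec_eq_iff scaleR_conv_of_real[where 'a = complex])
  then have "bounded_linear (cvec :: real ^ 'a \<Rightarrow> _)"
    by (simp add: linear_conv_bounded_linear)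
  moreover assume "(\<phi> has_vector_derivative d) (at x within I)"
  ultimately show "((\<lambda>x. cvec (\<phi> x)) has_vector_derivative cvec d) (at x within I)"
    by (rule bounded_linear.has_vector_derivative)
qed

definition outer :: "real ^ 'm \<Rightarrow> real ^ 'm \<Rightarrow> real ^ 'm ^ 'm" where
  "outer u v = (\<chi> i j. u $ i * v $ j)"

lemma columnvector_rowvector:
  "(columnvector (cvec v) :: complex ^ 1 ^ 'm) ** rowvector (cvec v) = cmat (outer v v)"
  by (simp add: vec_eq_iff matrix_matrix_mult_def columnvector_def rowvector_def cvec_def outer_def)

lemma linear_mult_cmat:
  fixes A :: "complex ^ 'd ^ 'a" and B :: "complex ^ 'b ^ 'c"
  shows "linear (\<lambda>Q. (A ** cmat Q ** B) $ a $ b)"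
proof (rule linearI)
  fix Q R :: "real ^ 'c ^ 'd" and r
  have "cmat (Q + R) = cmat Q + cmat R" "cmat (r *\<^sub>R Q) = mscale (of_real r) (cmat Q)"
    by (simp_all add: vec_eq_iff)
  then show "(A ** cmat (Q + R) ** B) $ a $ b = (A ** cmat Q ** B) $ a $ b + (A ** cmat R ** B) $ a $ b"
    "(A ** cmat (r *\<^sub>R Q) ** B) $ a $ b = r *\<^sub>R (A ** cmat Q ** B) $ a $ b"
    by (simp_all add: matrix_add_ldistrib mscale_mult_left mscale_mult_right scaleR_conv_of_real)
       (simp add: matrix_matrix_mult_def sum.distrib algebra_simps)
qed

lemma has_derivative_outer:
  fixes \<Phi> :: "real ^ 'm ^ 'r::finite"
  shows "((\<lambda>\<Psi>. (A ** cmat (outer (\<Psi> $ \<sigma>) (\<Psi> $ \<sigma>)) ** B) $ a $ b) has_derivative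
    (\<lambda>d. (A ** cmat (outer (\<Phi> $ \<sigma>) (d $ \<sigma>) + outer (d $ \<sigma>) (\<Phi> $ \<sigma>)) ** B) $ a $ b)) (at \<Phi>)"
proof -
  define \<beta> where "\<beta> u v = (A ** cmat (outer u v) ** B) $ a $ b" for u v
  have "linear (outer u)" "linear (\<lambda>u. outer u v)" for u v :: "real ^ 'm"
    by (auto simp: linear_iff outer_def vec_eq_iff algebra_simps)
  then have "linear (\<beta> u)" "linear (\<lambda>u. \<beta> u v)" for u v
    unfolding \<beta>_def using linear_mult_cmat[of A B a b] linear_compose by (auto simp: o_def)
  then have "bounded_bilinear \<beta>"
    by (simp add: bilinear_def flip: bilinear_conv_bounded_bilinear)
  moreover have "((\<lambda>\<Psi>. \<Psi> $ \<sigma>) has_derivative (\<lambda>d. d $ \<sigma>)) (at \<Phi>)"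
    by (rule bounded_linear_imp_has_derivative) (rule bounded_linear_vec_nth)
  ultimately have "((\<lambda>\<Psi>. \<beta> (\<Psi> $ \<sigma>) (\<Psi> $ \<sigma>)) has_derivative
      (\<lambda>d. \<beta> (\<Phi> $ \<sigma>) (d $ \<sigma>) + \<beta> (d $ \<sigma>) (\<Phi> $ \<sigma>))) (at \<Phi>)"
    using bounded_bilinear.FDERIV by blast
  then show ?thesis
    unfolding \<beta>_def by (simp add: linear_add[OF linear_mult_cmat])
qed

text \<open>The hypotheses make W B symmetric, so the two halves of the symmetrized product have
  equal traces; here the 2 in the denominator of H arises.\<close>

lemma trace_mult_symmetrized_outer:
  assumes "transpose B ** cmat W = mscale (- 1) (cmat W ** B)" "transpose (cmat W) = - cmat W"
  shows "trace (B ** cmat (outer u v + outer v u) ** cmat W)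
    = 2 * (\<Sum>k\<in>UNIV. of_real (v $ k) * (cmat W *v (B *v cvec u)) $ k)"
proof -
  define C where "C = cmat W ** B"
  have "transpose C = - (transpose B ** cmat W)"
    by (simp add: C_def matrix_transpose_mul assms(2) matrix_mul_uminus_right)
  also have "\<dots> = C"
    by (simp add: assms(1) C_def vec_eq_iff)
  finally have "transpose C $ i $ j = C $ i $ j" for i j
    by simp
  then have sym: "C $ j $ i = C $ i $ j" for i j
    by (simp add: transpose_def)
  have "trace (B ** cmat (outer u v + outer v u) ** cmat W) = trace (C ** cmat (outer u v + outer v u))"
    by (simp add: trace_mul_sym[of _ "cmat W"] C_def matrix_mul_assoc)
  also have "\<dots> = (\<Sum>i\<in>UNIV. \<Sum>j\<in>UNIV. C $ i $ j * of_real (v $ i * u $ j))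
      + (\<Sum>i\<in>UNIV. \<Sum>j\<in>UNIV. C $ i $ j * of_real (u $ i * v $ j))"
    by (simp add: trace_def matrix_matrix_mult_def outer_def algebra_simps sum.distrib)
  also have "(\<Sum>i\<in>UNIV. \<Sum>j\<in>UNIV. C $ i $ j * of_real (u $ i * v $ j))
    = (\<Sum>i\<in>UNIV. \<Sum>j\<in>UNIV. C $ i $ j * of_real (v $ i * u $ j))"
    by (subst sum.swap) (simp add: sym mult.commute)
  also have "(\<Sum>i\<in>UNIV. \<Sum>j\<in>UNIV. C $ i $ j * of_real (v $ i * u $ j))
    = (\<Sum>k\<in>UNIV. of_real (v $ k) * (C *v cvec u) $ k)"
    by (simp add: matrix_vector_mult_def cvec_def sum_distrib_left mult_ac)
  finally show ?thesis
    by (simp add: C_def matrix_vector_mul_assoc)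
qed

lemma has_mderiv_mult_left:
  assumes "has_mderiv T T' x"
  shows "has_mderiv (\<lambda>y. S ** T y) (\<lambda>d. S ** T' d) x"
  using has_mderiv_mult[OF has_mderiv_const[of S x] assms] by (simp add: matrix_mul_zero_left)

lemma has_mderiv_trace:
  "has_mderiv S S' x \<Longrightarrow>
    ((\<lambda>y. fps_nth (trace (S y)) k) has_derivative (\<lambda>d. fps_nth (trace (S' d)) k)) (at x)"
  by (auto simp: has_mderiv_def trace_def fps_sum_nth intro!: has_derivative_sum)


subsection \<open>The Hamiltonian\<close>

context reduction_group
begin

text \<open>\<open>K\<close> is constant and the polar part is linear in its matrices, so
  differentiation only replaces \<Phi>\<Phi>^T by its variation.\<close>

lemma has_mderiv_lax_series:
  fixes \<Phi> :: "real ^ 'm ^ 'r::finite"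
  shows "has_mderiv (\<lambda>\<Psi>. lax_series K c lam (\<lambda>\<sigma>. outer (\<Psi> $ \<sigma>) (\<Psi> $ \<sigma>)))
    (\<lambda>d. pole_part c lam (\<lambda>\<sigma>. outer (\<Phi> $ \<sigma>) (d $ \<sigma>) + outer (d $ \<sigma>) (\<Phi> $ \<sigma>))) \<Phi>"
  unfolding has_mderiv_def
proof (intro allI)
  fix a b k
  have pole: "((\<lambda>\<Psi>. mcoeff (pole_part c lam (\<lambda>\<sigma>. outer (\<Psi> $ \<sigma>) (\<Psi> $ \<sigma>))) k $ a $ b) has_derivative
    (\<lambda>d. mcoeff (pole_part c lam (\<lambda>\<sigma>. outer (\<Phi> $ \<sigma>) (d $ \<sigma>) + outer (d $ \<sigma>) (\<Phi> $ \<sigma>))) k $ a $ b)) (at \<Phi>)"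
  proof (cases k)
    case 0
    then show ?thesis
      by (simp add: mcoeff_pole_part)
  next
    case (Suc j)
    show ?thesis
      \<comment> \<open>The reassociation isolates the varying matrix between two fixed ones, the
        shape of \<open>has_derivative_outer\<close>.\<close>
      unfolding Suc mcoeff_pole_part(2) sum_component nth_map_matrix matrix_mul_assoc[of _ "transpose _", symmetric]
      by (intro has_derivative_sum has_derivative_mult_right has_derivative_outer)
  qed
  have "((\<lambda>\<Psi>. mcoeff (mconst K) k $ a $ b + mcoeff (pole_part c lam (\<lambda>\<sigma>. outer (\<Psi> $ \<sigma>) (\<Psi> $ \<sigma>))) k $ a $ b)
    has_derivative
    (\<lambda>d. 0 + mcoeff (pole_part c lam (\<lambda>\<sigma>. outer (\<Phi> $ \<sigma>) (d $ \<sigma>) + outer (d $ \<sigma>) (\<Phi> $ \<sigma>))) k $ a $ b)) (at \<Phi>)"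
    by (intro has_derivative_add has_derivative_const pole)
  then show "((\<lambda>\<Psi>. fps_nth (lax_series K c lam (\<lambda>\<sigma>. outer (\<Psi> $ \<sigma>) (\<Psi> $ \<sigma>)) $ a $ b) k) has_derivative
    (\<lambda>d. fps_nth (pole_part c lam (\<lambda>\<sigma>. outer (\<Phi> $ \<sigma>) (d $ \<sigma>) + outer (d $ \<sigma>) (\<Phi> $ \<sigma>)) $ a $ b) k)) (at \<Phi>)"
    by (simp add: lax_series_def mcoeff_nth)
qed

end

section \<open>The Lax matrix as an average over the group\<close>

context reduction_generators
begin

lemma weight_cong:
  assumes "weight d S" "[d = e] (mod int (Lcm (m ` {1..N})))"
  shows "weight e S"
proof -
  have "\<omega> g powi (d - int k) = \<omega> g powi (e - int k)" if "g \<in> G\<^sub>0" for g k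
    using assms(2) by (intro omega_powi_cong that cong_diff cong_refl)
  then show ?thesis
    using assms(1) by (simp add: weight_def)
qed

text \<open>\<kappa> times the uniform multiplicity with which \<open>Sigma0\<close> covers
  \<open>G\<^sub>0\<close>, the cardinality of \<open>Sigma0\<close> being the product of all
  \<open>m a\<close>.\<close>

definition average_factor :: "real \<Rightarrow> real" where
  "average_factor \<kappa> = \<kappa> * (real (\<Prod>a=1..N. m a) / real (card G\<^sub>0))"

text \<open>A change of sign of the group element affects neither \<omega> nor the summand, where
  the element occurs twice; so the averaging formula applies.\<close>

lemma expands_Lax:
  "expands_at_infinity (Lax W \<omega> N \<Omega> m K \<kappa> lam \<Phi>)
    (lax_series K (average_factor \<kappa>) lam (\<lambda>\<sigma>. outer (\<Phi> $ \<sigma>) (\<Phi> $ \<sigma>)))"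
proof -
  define T where "T g \<sigma> = g ** cmat (outer (\<Phi> $ \<sigma>) (\<Phi> $ \<sigma>)) ** transpose g ** cmat W" for g \<sigma>
  have T_pm: "T A \<sigma> = T B \<sigma>" if "pm_eq A B" for A B \<sigma>
    using that by (auto simp: pm_eq_def T_def transpose_uminus matrix_mul_uminus_left matrix_mul_uminus_right)
  have "Lax W \<omega> N \<Omega> m K \<kappa> lam \<Phi> l = K + (\<Sum>g\<in>G\<^sub>0. \<Sum>\<sigma>\<in>UNIV.
      mscale (of_real (average_factor \<kappa>) * (1 / (l - \<omega> g * of_real (lam \<sigma>)))) (T g \<sigma>))" for l
  proof -
    define \<Psi> where "\<Psi> g = (\<Sum>\<sigma>\<in>UNIV. mscale (1 / (l - \<omega> g * of_real (lam \<sigma>))) (T g \<sigma>))" for g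
    have "Lax W \<omega> N \<Omega> m K \<kappa> lam \<Phi> l
      = K + mscale (of_real \<kappa>) (\<Sum>\<alpha>\<in>Sigma0 N m. \<Psi> (Omega_pow N \<Omega> \<alpha>))"
      by (simp add: Lax_def \<Psi>_def T_def omega_pow_eq flip: columnvector_rowvector matrix_mul_assoc)
    also have "(\<Sum>\<alpha>\<in>Sigma0 N m. \<Psi> (Omega_pow N \<Omega> \<alpha>))
      = (real (\<Prod>a=1..N. m a) / real (card G\<^sub>0)) *\<^sub>R (\<Sum>g\<in>G\<^sub>0. \<Psi> g)"
    proof (rule sum_Sigma0_eq_average)
      fix A B
      assume AB: "A \<in> G\<^sub>0" "B \<in> G\<^sub>0" "pm_eq A B"
      show "\<Psi> A = \<Psi> B"
        unfolding \<Psi>_def omega_pm_eq[OF AB] T_pm[OF AB(3)] ..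
    qed
    also have "\<dots> = mscale (of_real (real (\<Prod>a=1..N. m a) / real (card G\<^sub>0))) (\<Sum>g\<in>G\<^sub>0. \<Psi> g)"
      by (simp add: vec_eq_iff scaleR_conv_of_real[where 'a = complex])
    finally show ?thesis
      by (simp add: \<Psi>_def average_factor_def mscale_mscale mscale_sum)
  qed
  then have "Lax W \<omega> N \<Omega> m K \<kappa> lam \<Phi> = (\<lambda>l. K + (\<Sum>g\<in>G\<^sub>0. \<Sum>\<sigma>\<in>UNIV.
      mscale (of_real (average_factor \<kappa>) * (1 / (l - \<omega> g * of_real (lam \<sigma>)))) (T g \<sigma>)))" ..
  then show ?thesis
    unfolding lax_series_def T_def by (simp only: expands_add expands_const expands_pole_part)
qed

end

section \<open>Polynomials in a matrix of series and the variation of their trace\<close>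

lemma trace_fscale: "trace (fscale c S) = fps_const c * trace S"
  by (simp add: trace_def sum_distrib_left)

lemma map_matrix_zero: "map_matrix ((*) (0::'a::mult_zero)) S = 0"
  by (simp add: vec_eq_iff)

lemma mconst_scaleR: "mconst (r *\<^sub>R A) = fscale (of_real r) (mconst A)"
  by (simp add: vec_eq_iff scaleR_conv_of_real[where 'a = complex])

lemma has_mderiv_fscale: "has_mderiv S S' x \<Longrightarrow> has_mderiv (\<lambda>y. fscale c (S y)) (\<lambda>d. fscale c (S' d)) x"
  by (auto simp: has_mderiv_def intro!: has_derivative_mult_right)

lemma has_mderiv_sum:
  "(\<And>i. i \<in> I \<Longrightarrow> has_mderiv (S i) (S' i) x) \<Longrightarrow>
    has_mderiv (\<lambda>y. \<Sum>i\<in>I. S i y) (\<lambda>d. \<Sum>i\<in>I. S' i d) x"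
  by (auto simp: has_mderiv_def fps_sum_nth intro!: has_derivative_sum)

text \<open>Coefficients and length are parameters because f and its antiderivative share the same
  \<theta>: one is used with \<open>a\<close> and \<open>n\<close>, the other with \<open>b\<close>
  and \<open>Suc n\<close>.\<close>

definition poly_series ::
  "complex ^ 'm ^ 'm \<Rightarrow> (nat \<Rightarrow> real) \<Rightarrow> nat \<Rightarrow> complex fps ^ 'm ^ 'm \<Rightarrow> complex fps ^ 'm ^ 'm" where
  "poly_series \<theta> a n S = (\<Sum>i<n. fscale (of_real (a i)) (mconst \<theta> ** fpow S i))"

lemma expands_mpoly_mat:
  assumes coeff: "\<And>i. Polynomial.coeff f i = (if i < n then a i *\<^sub>R \<theta> else 0)"
    and Q: "expands_at_infinity Q S"
  shows "expands_at_infinity (\<lambda>l. mpoly_mat f (Q l)) (poly_series \<theta> a n S)"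
proof -
  have "mpoly_mat f X = (\<Sum>i<n. (a i *\<^sub>R \<theta>) ** mpow X i)" for X
    by (simp add: mpoly_mat_eq[of n f] coeff)
  moreover have "expands_at_infinity (\<lambda>l. \<Sum>i<n. (a i *\<^sub>R \<theta>) ** mpow (Q l) i) (poly_series \<theta> a n S)"
    unfolding poly_series_def fscale_mult_left[symmetric] mconst_scaleR[symmetric]
    by (intro expands_sum expands_mult expands_const expands_mpow Q)
  ultimately show ?thesis
    by simp
qed

text \<open>The chain rule under the trace, at the level of series: the hypothesis on
  \<open>b\<close> says that \<open>a\<close> lists the coefficients of the derivative, and its
  factor \<open>Suc i\<close> matches the one in \<open>trace_fpow_deriv\<close>.\<close>

lemma has_derivative_trace_poly_series:
  assumes S: "has_mderiv S S' x" and comm: "mconst \<theta> ** S x = S x ** mconst \<theta>"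
    and b: "\<And>i. i < n \<Longrightarrow> b (Suc i) * real (Suc i) = a i"
  shows "((\<lambda>y. fps_nth (trace (poly_series \<theta> b (Suc n) (S y))) k) has_derivative
    (\<lambda>d. fps_nth (trace (poly_series \<theta> a n (S x) ** S' d)) k)) (at x)"
proof -
  have "trace (\<Sum>i<Suc n. fscale (of_real (b i)) (mconst \<theta> ** fpow_deriv (S x) (S' d) i))
    = trace (poly_series \<theta> a n (S x) ** S' d)" for d
  proof -
    have step: "fps_const (complex_of_real (b (Suc i))) * trace (mconst \<theta> ** fpow_deriv (S x) (S' d) (Suc i))
      = fps_const (of_real (a i)) * trace (mconst \<theta> ** fpow (S x) i ** S' d)" if "i < n" for i
    proof -
      have "fps_const (complex_of_real (a i)) = fps_const (of_real (b (Suc i))) * of_nat (Suc i)"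
        by (simp only: b[OF that, symmetric] of_real_mult fps_const_mult[symmetric] of_real_of_nat_eq
            fps_of_nat)
      then show ?thesis
        by (simp only: trace_fpow_deriv[OF comm] mult.assoc)
    qed
    have zero: "trace (mconst \<theta> ** fpow_deriv (S x) (S' d) 0) = 0"
      by (simp add: matrix_mul_zero_right trace_def)
    have "trace (\<Sum>i<Suc n. fscale (of_real (b i)) (mconst \<theta> ** fpow_deriv (S x) (S' d) i))
      = (\<Sum>i<n. fps_const (of_real (b (Suc i))) * trace (mconst \<theta> ** fpow_deriv (S x) (S' d) (Suc i)))"
      unfolding trace_sum trace_fscale unfolding sum.lessThan_Suc_shift zero by simp
    also have "\<dots> = (\<Sum>i<n. fps_const (of_real (a i)) * trace (mconst \<theta> ** fpow (S x) i ** S' d))"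
      by (intro sum.cong refl step) simp
    also have "\<dots> = trace (poly_series \<theta> a n (S x) ** S' d)"
      by (simp add: poly_series_def matrix_mul_sum_left trace_sum fscale_mult_left trace_fscale)
    finally show ?thesis .
  qed
  moreover have "has_mderiv (\<lambda>y. poly_series \<theta> b (Suc n) (S y))
    (\<lambda>d. \<Sum>i<Suc n. fscale (of_real (b i)) (mconst \<theta> ** fpow_deriv (S x) (S' d) i)) x"
    unfolding poly_series_def
    by (intro has_mderiv_sum has_mderiv_fscale has_mderiv_mult_left has_mderiv_fpow S)
  ultimately show ?thesis
    using has_mderiv_trace by fastforce
qed

text \<open>The value at \<lambda> = x of the polynomial part of \<lambda>^p S, in the form given by
  \<open>inf_plus_expansion\<close>.\<close>

definition plus_part :: "nat \<Rightarrow> complex \<Rightarrow> complex fps ^ 'm ^ 'm \<Rightarrow> complex ^ 'm ^ 'm" where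
  "plus_part p x S = (\<Sum>k\<le>p. mscale (x ^ (p - k)) (mcoeff S k))"

section \<open>The gradient of the Hamiltonian\<close>

context reduction_generators
begin

definition lax_at ::
  "complex ^ 'm ^ 'm \<Rightarrow> real \<Rightarrow> ('r::finite \<Rightarrow> real) \<Rightarrow> real ^ 'm ^ 'r \<Rightarrow> complex fps ^ 'm ^ 'm" where
  "lax_at K \<kappa> lam \<Phi> = lax_series K (average_factor \<kappa>) lam (\<lambda>\<sigma>. outer (\<Phi> $ \<sigma>) (\<Phi> $ \<sigma>))"

context
  fixes K \<theta> :: "complex ^ 'm ^ 'm" and h :: int and p n :: nat and a :: "nat \<Rightarrow> real"
    and lam :: "'r::finite \<Rightarrow> real" and \<kappa> :: real
  assumes K: "K \<in> D_set W G\<^sub>0 \<omega> 1" and \<theta>: "\<theta> \<in> Theta_set W G\<^sub>0 \<omega> h"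
    and a: "\<And>i. i < n \<Longrightarrow> a i \<noteq> 0 \<Longrightarrow> odd i \<and> [h + int i = int p] (mod int (Lcm (m ` {1..N})))"
begin

abbreviation "S \<equiv> lax_at K \<kappa> lam"

abbreviation "B \<Phi> \<sigma> \<equiv> plus_part p (of_real (lam \<sigma>)) (poly_series \<theta> a n (S \<Phi>))"

lemma S_props: "weight 1 (S \<Phi>)" "real_coeffs (S \<Phi>)" "twisted W (- 1) (S \<Phi>)"
  unfolding lax_at_def by (intro lax_series K; simp add: outer_def transpose_def vec_eq_iff mult.commute)+

lemma real_coeffs_poly_series: "real_coeffs (poly_series \<theta> b k (S \<Phi>))"
  unfolding poly_series_def
  by (intro real_coeffs_sum real_coeffs_fscale real_coeffs_mult real_coeffs_fpow Theta_set(2)[OF \<theta>] S_props)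

lemma \<theta>_commute: "mconst \<theta> ** S \<Phi> = S \<Phi> ** mconst \<theta>"
  by (rule Theta_set_commute[OF \<theta> S_props(1)])

text \<open>The i-th term has weight h + i, and the congruence on non-zero coefficients turns all
  these weights into p.\<close>

lemma weight_poly_series: "weight (int p) (poly_series \<theta> a n (S \<Phi>))"
  unfolding poly_series_def
proof (intro weight_sum)
  fix i
  assume i: "i \<in> {..<n}"
  show "weight (int p) (fscale (of_real (a i)) (mconst \<theta> ** fpow (S \<Phi>) i))"
  proof (cases "a i = 0")
    case True
    then show ?thesis
      using weight_sum[of "{}" "int p"] by (simp add: map_matrix_zero)
  next
    case False
    have "weight (h + int i) (mconst \<theta> ** fpow (S \<Phi>) i)"
      by (intro weight_mult Theta_set(1)[OF \<theta>] weight_fpow S_props)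
    then show ?thesis
      using a[of i] False i by (intro weight_fscale) (auto intro: weight_cong)
  qed
qed

lemma twisted_poly_series: "twisted W (- 1) (poly_series \<theta> a n (S \<Phi>))"
  unfolding poly_series_def
proof (intro twisted_sum)
  fix i
  assume i: "i \<in> {..<n}"
  show "twisted W (- 1) (fscale (of_real (a i)) (mconst \<theta> ** fpow (S \<Phi>) i))"
  proof (cases "a i = 0")
    case True
    then show ?thesis
      using twisted_sum[of "{}" W "- 1"] by (simp add: map_matrix_zero)
  next
    case False
    then have "odd i"
      using a i by auto
    \<comment> \<open>\<theta> contributes the sign +1 and each factor S contributes -1, so odd
      powers keep the sign of the Lie algebra.\<close>
    moreover have "twisted W (1 * (- 1) ^ i) (mconst \<theta> ** fpow (S \<Phi>) i)"
      by (intro twisted_mult Theta_set(3)[OF \<theta>] twisted_fpow S_props fpow_commute \<theta>_commute)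
    ultimately show ?thesis
      by (intro twisted_fscale) simp
  qed
qed

lemma B_twisted: "transpose (B \<Phi> \<sigma>) ** cmat W = mscale (- 1) (cmat W ** B \<Phi> \<sigma>)"
  using twisted_poly_series[of \<Phi>]
  by (simp add: plus_part_def twisted_def transpose_sum transpose_mscale matrix_mul_sum_left matrix_mul_sum_right
      mscale_mult_left mscale_mult_right mscale_sum mscale_mscale mult.commute)

text \<open>The coefficients are real matrices and the evaluation point \<open>lam \<sigma>\<close>
  is real.\<close>

lemma B_real: "B \<Phi> \<sigma> = cmat (\<chi> i j. Re (B \<Phi> \<sigma> $ i $ j))"
proof -
  have "conj_mat (B \<Phi> \<sigma>) = B \<Phi> \<sigma>"
    using real_coeffs_poly_series[of a n \<Phi>]
    by (simp add: plus_part_def conj_mat_sum conj_mat_mscale real_coeffs_def)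
  then have "cnj (B \<Phi> \<sigma> $ i $ j) = B \<Phi> \<sigma> $ i $ j" for i j
    by (metis nth_map_matrix)
  then show ?thesis
    by (simp add: vec_eq_iff complex_eq_iff)
qed

lemma has_derivative_hamiltonian:
  assumes \<kappa>: "\<kappa> \<noteq> 0" and b: "\<And>i. i < n \<Longrightarrow> b (Suc i) * real (Suc i) = a i"
  shows "((\<lambda>\<Psi>. 1 / (2 * of_real \<kappa> * of_nat (\<Prod>a=1..N. m a)) *
      fps_nth (trace (poly_series \<theta> b (Suc n) (S \<Psi>))) (Suc p)) has_derivative
    (\<lambda>d. \<Sum>\<sigma>\<in>UNIV. \<Sum>k\<in>UNIV. of_real (d $ \<sigma> $ k) * (cmat W *v (B \<Phi> \<sigma> *v cvec (\<Phi> $ \<sigma>))) $ k)) (at \<Phi>)"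
proof -
  define dS where "dS d = pole_part (average_factor \<kappa>) lam
    (\<lambda>\<sigma>. outer (\<Phi> $ \<sigma>) (d $ \<sigma>) + outer (d $ \<sigma>) (\<Phi> $ \<sigma>))" for d :: "real ^ 'm ^ 'r"
  define M where "M = (\<Prod>a=1..N. m a)"
  have M: "M \<noteq> 0"
    using m_pos by (force simp: M_def)
  have card: "card G\<^sub>0 \<noteq> 0"
    using finite_G0 G0_one by auto
  have S: "has_mderiv S dS \<Phi>"
    unfolding lax_at_def dS_def by (rule has_mderiv_lax_series)
  have "fps_nth (trace (poly_series \<theta> a n (S \<Phi>) ** dS d)) (Suc p)
    = (2 * of_real \<kappa> * of_nat M) *
      (\<Sum>\<sigma>\<in>UNIV. \<Sum>k\<in>UNIV. of_real (d $ \<sigma> $ k) * (cmat W *v (B \<Phi> \<sigma> *v cvec (\<Phi> $ \<sigma>))) $ k)" for d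
  proof -
    have "fps_nth (trace (poly_series \<theta> a n (S \<Phi>) ** dS d)) (Suc p)
      = of_real (average_factor \<kappa> * real (card G\<^sub>0)) * (\<Sum>\<sigma>\<in>UNIV.
        trace (B \<Phi> \<sigma> ** cmat (outer (\<Phi> $ \<sigma>) (d $ \<sigma>) + outer (d $ \<sigma>) (\<Phi> $ \<sigma>)) ** cmat W))"
      unfolding dS_def plus_part_def by (rule trace_mult_pole_part[OF weight_poly_series])
    \<comment> \<open>The orbit size cancels the denominator of the averaging; \<kappa> times the
      product of the \<open>m a\<close> is left for the normalization of H to remove.\<close>
    also have "average_factor \<kappa> * real (card G\<^sub>0) = \<kappa> * real M"
      using card by (simp add: average_factor_def M_def)
    finally show ?thesis
      by (simp add: trace_mult_symmetrized_outer[OF B_twisted transpose_cmat_W] mult_ac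
          flip: sum_distrib_left)
  qed
  then have eq: "1 / (2 * of_real \<kappa> * of_nat M) * fps_nth (trace (poly_series \<theta> a n (S \<Phi>) ** dS d)) (Suc p)
    = (\<Sum>\<sigma>\<in>UNIV. \<Sum>k\<in>UNIV. of_real (d $ \<sigma> $ k) * (cmat W *v (B \<Phi> \<sigma> *v cvec (\<Phi> $ \<sigma>))) $ k)" for d
    using M \<kappa> by simp
  show ?thesis
    unfolding M_def[symmetric] eq[symmetric]
    by (intro has_derivative_mult_right has_derivative_trace_poly_series S \<theta>_commute b)
qed

end

end

section \<open>From the gradient to Hamilton's equations\<close>

lemma phase_partial_eq:
  assumes "(H has_derivative (\<lambda>d. \<Sum>\<sigma>\<in>UNIV. \<Sum>k\<in>UNIV. d $ \<sigma> $ k * v \<sigma> $ k)) (at \<Phi>)"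
  shows "phase_partial H k \<sigma> \<Phi> = v \<sigma> $ k"
proof -
  let ?e = "axis \<sigma> (axis k 1) :: real ^ 'a ^ 'b"
  have line: "((\<lambda>t. \<Phi> + t *\<^sub>R ?e) has_derivative (\<lambda>t. 0 + t *\<^sub>R ?e)) (at 0)"
    by (intro derivative_intros)
  have "(H has_derivative (\<lambda>d. \<Sum>\<sigma>\<in>UNIV. \<Sum>k\<in>UNIV. d $ \<sigma> $ k * v \<sigma> $ k)) (at (\<Phi> + 0 *\<^sub>R ?e))"
    using assms by simp
  from has_derivative_compose[OF line this] have "((\<lambda>t. H (\<Phi> + t *\<^sub>R ?e)) has_derivative
      (\<lambda>t. \<Sum>\<tau>\<in>UNIV. \<Sum>j\<in>UNIV. (0 + t *\<^sub>R ?e) $ \<tau> $ j * v \<tau> $ j)) (at 0)" .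
  moreover have "(\<Sum>\<tau>\<in>UNIV. \<Sum>j\<in>UNIV. (0 + t *\<^sub>R ?e) $ \<tau> $ j * v \<tau> $ j) = v \<sigma> $ k * t" for t
  proof -
    have "(\<Sum>j\<in>UNIV. (0 + t *\<^sub>R ?e) $ \<tau> $ j * v \<tau> $ j) = (if \<tau> = \<sigma> then v \<sigma> $ k * t else 0)" for \<tau>
    proof (cases "\<tau> = \<sigma>")
      case True
      then have "(0 + t *\<^sub>R ?e) $ \<tau> $ j * v \<tau> $ j = (if j = k then v \<sigma> $ k * t else 0)" for j
        by (simp add: axis_def)
      with True show ?thesis
        by simp
    qed (simp add: axis_def)
    then show ?thesis
      by simp
  qed
  ultimately have "((\<lambda>t. H (\<Phi> + t *\<^sub>R ?e)) has_field_derivative v \<sigma> $ k) (at 0)"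
    by (simp add: has_field_derivative_def)
  then show ?thesis
    unfolding phase_partial_def by (rule DERIV_imp_deriv)
qed

text \<open>Reality and differentiability of H are part of the conclusion: they ensure that passing
  to \<open>Re\<close> loses nothing and that the partial derivatives, defined through
  \<open>deriv\<close>, are genuine. The last conjunct compares solution curves on an arbitrary set
  of times.\<close>

theorem theorem2:
  fixes W :: "real ^ 'm ^ 'm" and n :: nat
    and G\<^sub>0 :: "(complex ^ 'm ^ 'm) set"
    and N :: nat and \<Omega> :: "nat \<Rightarrow> complex ^ 'm ^ 'm"
    and m :: "nat \<Rightarrow> nat" and m\<^sub>0 :: nat
    and \<omega> :: "complex ^ 'm ^ 'm \<Rightarrow> complex"
    and lam :: "'r::finite \<Rightarrow> real" and \<kappa> :: real
    and p h :: int
    and f F :: "(complex ^ 'm ^ 'm) poly"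
    and K :: "complex ^ 'm ^ 'm"
    and L :: "real ^ 'm ^ 'r \<Rightarrow> complex \<Rightarrow> complex ^ 'm ^ 'm"
    and H :: "real ^ 'm ^ 'r \<Rightarrow> complex"
  assumes dim: "CARD('m) = 2 * n"
    and W: "invertible W" "transpose W = - W"
    and G0: "subgroup G\<^sub>0 (GW W)" "finite G\<^sub>0"
    and G0_conj: "\<And>A. A \<in> G\<^sub>0 \<Longrightarrow> conj_mat A ** A = mat 1 \<or> conj_mat A ** A = - mat 1"
    and Omega_in: "\<And>a. a \<in> {1..N} \<Longrightarrow> \<Omega> a \<in> G\<^sub>0"
    and Omega_gen: "generate (PGW W) ((\<lambda>a. pr W (\<Omega> a)) ` {1..N}) = pr W ` G\<^sub>0"
    and m: "\<And>a. a \<in> {1..N} \<Longrightarrow> m a = group.ord (PGW W) (pr W (\<Omega> a))"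
    and m0: "m\<^sub>0 = Lcm (m ` {1..N})"
    and omega_hom: "\<omega> \<in> hom ((GW W)\<lparr>carrier := G\<^sub>0\<rparr>) circle_group"
    and omega_pm: "\<And>A. A \<in> G\<^sub>0 \<inter> pm_one \<Longrightarrow> \<omega> A = 1"
    and lam: "\<And>\<sigma>. lam \<sigma> \<noteq> 0" "inj (\<lambda>\<sigma>. (lam \<sigma>)\<^sup>2)"
    and kappa: "\<kappa> \<noteq> 0"
    and p: "p \<ge> 1"
    and f: "f \<in> F_set W G\<^sub>0 \<omega> m\<^sub>0 p h"
    and F: "\<And>\<tau>. (mpoly_at F has_vector_derivative mpoly_at f \<tau>) (at \<tau>)" "mpoly_at F 0 = 0"
    and K: "K \<in> D_set W G\<^sub>0 \<omega> 1"
    and L: "L = Lax W \<omega> N \<Omega> m K \<kappa> lam"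
    and H: "H = lax_hamiltonian p F \<kappa> N m L"
  shows "(\<forall>\<Phi>. H \<Phi> \<in> \<real>) \<and>
    (\<forall>\<Phi>. (\<lambda>\<Psi>. Re (H \<Psi>)) differentiable (at \<Phi>)) \<and>
    (\<forall>\<Phi> \<sigma>. lax_rhs p f lam L \<Phi> \<sigma> = cvec (hamiltonian_rhs W (\<lambda>\<Psi>. Re (H \<Psi>)) \<Phi> \<sigma>)) \<and>
    (\<forall>(\<phi> :: real \<Rightarrow> real ^ 'm ^ 'r) I.
      (\<forall>x\<in>I. \<forall>\<sigma>. ((\<lambda>x. cvec (\<phi> x $ \<sigma>)) has_vector_derivative lax_rhs p f lam L (\<phi> x) \<sigma>)
         (at x within I)) \<longleftrightarrow>
      (\<forall>x\<in>I. \<forall>\<sigma>. ((\<lambda>x. \<phi> x $ \<sigma>) has_vector_derivative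
           hamiltonian_rhs W (\<lambda>\<Psi>. Re (H \<Psi>)) (\<phi> x) \<sigma>) (at x within I)))"
proof -
  interpret reduction_generators W G\<^sub>0 \<omega> N \<Omega> m
    by (rule reduction_generators.intro[OF reduction_group.intro reduction_generators_axioms.intro])
       (fact W G0 G0_conj omega_hom omega_pm Omega_in Omega_gen m)+
  obtain q where q: "p = int q"
    using p by (metis int_nat_eq less_le_trans linorder_not_le nonneg_int_cases zero_less_one less_imp_le)
  obtain s \<theta> and a :: "nat \<Rightarrow> real" where \<theta>: "\<theta> \<in> Theta_set W G\<^sub>0 \<omega> h"
    and a: "\<And>i. i < s \<Longrightarrow> a i \<noteq> 0 \<Longrightarrow> odd i \<and> [h + int i = int q] (mod int (Lcm (m ` {1..N})))"
    and coeff_f: "\<And>i. Polynomial.coeff f i = (if i < s then a i *\<^sub>R \<theta> else 0)"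
    using F_set_cases[OF f] unfolding m0 q by metis
  \<comment> \<open>The coefficients of \<open>F\<close>: zero constant term from F(0) = 0, then
    those of f divided by the new exponent.\<close>
  define b where "b i = (if i = 0 then 0 else a (i - 1) / real i)" for i
  have coeff_F: "Polynomial.coeff F i = (if i < Suc s then b i *\<^sub>R \<theta> else 0)" for i
    using mpoly_antiderivative_coeff[OF F] by (cases i) (auto simp: coeff_f b_def)
  define T where "T = lax_at K \<kappa> lam"
  define C where "C \<Phi> \<sigma> = plus_part q (of_real (lam \<sigma>)) (poly_series \<theta> a s (T \<Phi>))" for \<Phi> \<sigma>
  have T: "expands_at_infinity (L \<Phi>) (T \<Phi>)" for \<Phi>
    unfolding L T_def lax_at_def by (rule expands_Lax)
  have H_eq: "H \<Phi> = 1 / (2 * of_real \<kappa> * of_nat (\<Prod>a=1..N. m a)) *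
      fps_nth (trace (poly_series \<theta> b (Suc s) (T \<Phi>))) (Suc q)" for \<Phi>
    using Res_expansion[OF expands_mpoly_mat[OF coeff_F T], of p \<Phi>] p
    by (simp add: H lax_hamiltonian_def q trace_mcoeff)
  have rhs: "lax_rhs p f lam L \<Phi> \<sigma> = C \<Phi> \<sigma> *v cvec (\<Phi> $ \<sigma>)" for \<Phi> \<sigma>
    using inf_plus_expansion[OF expands_mpoly_mat[OF coeff_f T], of p \<Phi> "of_real (lam \<sigma>)"] p
    by (simp add: lax_rhs_def C_def plus_part_def T_def q)
  define R where "R \<Phi> \<sigma> = (\<chi> i j. Re (C \<Phi> \<sigma> $ i $ j))" for \<Phi> \<sigma>
  have C_real: "C \<Phi> \<sigma> = cmat (R \<Phi> \<sigma>)" for \<Phi> \<sigma>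
    unfolding R_def C_def T_def by (rule B_real[OF K \<theta> a])
  have H_real: "H \<Phi> \<in> \<real>" for \<Phi>
  proof -
    have "real_coeffs (poly_series \<theta> b (Suc s) (T \<Phi>))"
      unfolding T_def by (rule real_coeffs_poly_series[OF K \<theta> a])
    then have "cnj (mcoeff (poly_series \<theta> b (Suc s) (T \<Phi>)) (Suc q) $ i $ i)
      = mcoeff (poly_series \<theta> b (Suc s) (T \<Phi>)) (Suc q) $ i $ i" for i
      unfolding real_coeffs_def by (metis nth_map_matrix)
    then have "trace (mcoeff (poly_series \<theta> b (Suc s) (T \<Phi>)) (Suc q)) \<in> \<real>"
      unfolding trace_def by (intro sum_in_Reals) (simp add: Reals_cnj_iff)
    then show ?thesis
      unfolding H_eq by (intro Reals_mult Reals_divide) (auto simp: trace_mcoeff)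
  qed
  have deriv: "((\<lambda>\<Psi>. Re (H \<Psi>)) has_derivative
      (\<lambda>d. \<Sum>\<sigma>\<in>UNIV. \<Sum>k\<in>UNIV. d $ \<sigma> $ k * (W *v (R \<Phi> \<sigma> *v \<Phi> $ \<sigma>)) $ k)) (at \<Phi>)" for \<Phi>
  proof -
    have "b (Suc i) * real (Suc i) = a i" for i
      by (simp add: b_def)
    then have "(H has_derivative
        (\<lambda>d. \<Sum>\<sigma>\<in>UNIV. \<Sum>k\<in>UNIV. of_real (d $ \<sigma> $ k) * (cmat W *v (C \<Phi> \<sigma> *v cvec (\<Phi> $ \<sigma>))) $ k)) (at \<Phi>)"
      using has_derivative_hamiltonian[OF K \<theta> a kappa, where b = b and lam = lam and \<Phi> = \<Phi>]
      unfolding H_eq[abs_def] T_def C_def by blast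
    from has_derivative_Re[OF this] show ?thesis
      by (simp add: C_real cmat_mult_cvec) (simp add: cvec_def)
  qed
  have eq: "lax_rhs p f lam L \<Phi> \<sigma> = cvec (hamiltonian_rhs W (\<lambda>\<Psi>. Re (H \<Psi>)) \<Phi> \<sigma>)" for \<Phi> \<sigma>
  proof -
    \<comment> \<open>The gradient in each \<Phi>_\<sigma> is W R \<Phi>_\<sigma>, so the inverse of
      \<open>W\<close> in Hamilton's equations cancels it to the Lax flow.\<close>
    have "hamiltonian_rhs W (\<lambda>\<Psi>. Re (H \<Psi>)) \<Phi> \<sigma> = matrix_inv W *v (W *v (R \<Phi> \<sigma> *v \<Phi> $ \<sigma>))"
      unfolding hamiltonian_rhs_def phase_partial_eq[OF deriv] by (simp add: matrix_vector_mult_def)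
    also have "\<dots> = R \<Phi> \<sigma> *v \<Phi> $ \<sigma>"
      by (simp add: matrix_vector_mul_assoc matrix_mul_assoc matrix_inv_cancel[OF W(1)])
    finally show ?thesis
      by (simp add: rhs C_real cmat_mult_cvec)
  qed
  show ?thesis
    using H_real deriv by (auto simp: eq has_vector_derivative_cvec_iff differentiable_def)
qed

end
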